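(* For every integer $k\geq 2$ we have $\mathcal{TC}(\mathrm{SLT}_k)=\mathrm{CS}$, and moreover $\mathcal{TC}(\mathrm{SLT})=\mathrm{CS}$.
   Context: A tree-controlled grammar is a quintuple $G=(N,T,P,S,R)$ where $(N,T,P,S)$ is a context-free grammar (non-terminals $N$, terminals $T$, axiom $S$) whose rules are all non-erasing, except that the rule $S\to\lambda$ is allowed if $S$ does not occur on the right-hand side of any rule, and $R\subseteq (N\cup T)^*$ is a regular language (the control language). For a derivation tree $t$ of height $h$ and $0\le j\le h$, the word of level $j$ is the word formed by reading all nodes of depth $j$ from left to right. $L(G)$ consists of all $z\in T^*$ having a derivation tree $t$ whose leaves read from left to right give $z$ and such that the words of all levels of $t$, except the last level, belong to $R$. For a family $\mathcal F$ of regular languages, $\mathcal{TC}(\mathcal F)$ is the family of languages $L(G)$ of tree-controlled grammars $G=(N,T,P,S,R)$ with $R\in\mathcal F$. $\mathrm{CS}$ denotes the family of context-sensitive languages. Strictly locally testable languages: let $V$ be an alphabet and $k\ge1$. For $B,I,E\subseteq V^k$ and $F\subseteq V^{\le k-1}$ (words of length at most $k-1$), $\mathrm{slt}(B,I,E,F)$ denotes the language over $V$ consisting of all words in $F$ together with all words $a_1a_2\cdots a_n$ ($a_i\in V$, $n\ge k$) such that $a_1\cdots a_k\in B$, $a_{j+1}\cdots a_{j+k}\in I$ for every $j$ with $1\le j\le n-k-1$, and $a_{n-k+1}\cdots a_n\in E$. A language is strictly locally $k$-testable if it equals $\mathrm{slt}(B,I,E,F)$ for some such $V,B,I,E,F$;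 $\mathrm{SLT}_k$ is the family of these languages and $\mathrm{SLT}=\bigcup_{k\ge1}\mathrm{SLT}_k$. *)

theory Defs
  imports Main
begin

(* Grammar symbols: nonterminals are drawn from nat (any finite set of nonterminals
   can be renamed into nat), terminals from an arbitrary type 't. *)
datatype 't sym = Nt nat | Tm 't

definition syms :: "nat set \<Rightarrow> 't set \<Rightarrow> 't sym set" where
  "syms N T = Nt ` N \<union> Tm ` T"

definition slt :: "nat \<Rightarrow> 'a set \<Rightarrow> 'a list set \<Rightarrow> 'a list set \<Rightarrow> 'a list set \<Rightarrow> 'a list set \<Rightarrow> 'a list set" where
  "slt k V B I E F = F \<union>
     {w. set w \<subseteq> V \<and> length w \<ge> k \<and> take k w \<in> B
         \<and> (\<forall>j. 1 \<le> j \<and> j + k + 1 \<le> length w \<longrightarrow> take k (drop j w) \<in> I)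
         \<and> drop (length w - k) w \<in> E}"

(* SLT_k (k >= 1 intended) *)
definition SLT_k :: "nat \<Rightarrow> 'a list set set" where
  "SLT_k k = {L. \<exists>V B I E F. finite V
      \<and> B \<subseteq> {w. set w \<subseteq> V \<and> length w = k}
      \<and> I \<subseteq> {w. set w \<subseteq> V \<and> length w = k}
      \<and> E \<subseteq> {w. set w \<subseteq> V \<and> length w = k}
      \<and> F \<subseteq> {w. set w \<subseteq> V \<and> length w \<le> k - 1}
      \<and> L = slt k V B I E F}"

definition SLT :: "'a list set set" where
  "SLT = (\<Union>k\<in>{k. k \<ge> 1}. SLT_k k)"

(* Derivation trees: a leaf labelled by a terminal, a leaf labelled lambda
   (child of a node rewritten by an erasing rule), or an inner node labelled by a
   nonterminal with a nonempty list of children. *)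
datatype 't dtree = Leaf 't | Lam | Inner nat "'t dtree list"

fun lab :: "'t dtree \<Rightarrow> 't sym list" where
  "lab (Leaf a) = [Tm a]"
| "lab Lam = []"
| "lab (Inner A ts) = [Nt A]"

fun level :: "'t dtree \<Rightarrow> nat \<Rightarrow> 't sym list" where
  "level t 0 = lab t"
| "level (Inner A ts) (Suc j) = concat (map (\<lambda>s. level s j) ts)"
| "level (Leaf a) (Suc j) = []"
| "level Lam (Suc j) = []"

fun height :: "'t dtree \<Rightarrow> nat" where
  "height (Leaf a) = 0"
| "height Lam = 0"
| "height (Inner A ts) = Suc (foldr max (map height ts) 0)"

fun yield :: "'t dtree \<Rightarrow> 't list" where
  "yield (Leaf a) = [a]"
| "yield Lam = []"
| "yield (Inner A ts) = concat (map yield ts)"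

(* validity w.r.t. a rule set P: every inner node labelled A with children ts
   corresponds to a rule A -> (labels of the children); an erasing rule A -> lambda
   is represented by a single lambda child. *)
fun valid :: "(nat \<times> 't sym list) set \<Rightarrow> 't dtree \<Rightarrow> bool" where
  "valid P (Leaf a) = True"
| "valid P Lam = True"
| "valid P (Inner A ts) = (ts \<noteq> [] \<and> (ts = [Lam] \<or> Lam \<notin> set ts)
      \<and> (A, concat (map lab ts)) \<in> P \<and> (\<forall>t\<in>set ts. valid P t))"

definition cf_grammar :: "nat set \<Rightarrow> 't set \<Rightarrow> (nat \<times> 't sym list) set \<Rightarrow> nat \<Rightarrow> bool" where
  "cf_grammar N T P S \<longleftrightarrow> finite N \<and> finite T \<and> finite P \<and> S \<in> N
     \<and> (\<forall>(A, w) \<in> P. A \<in> N \<and> set w \<subseteq> syms N T)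
     \<and> (\<forall>(A, w) \<in> P. w = [] \<longrightarrow> A = S \<and> (\<forall>(B, u) \<in> P. Nt S \<notin> set u))"

definition tc_grammar :: "nat set \<Rightarrow> 't set \<Rightarrow> (nat \<times> 't sym list) set \<Rightarrow> nat \<Rightarrow> 't sym list set \<Rightarrow> bool" where
  "tc_grammar N T P S R \<longleftrightarrow> cf_grammar N T P S \<and> R \<subseteq> lists (syms N T)"

definition tc_lang :: "(nat \<times> 't sym list) set \<Rightarrow> nat \<Rightarrow> 't sym list set \<Rightarrow> 't list set" where
  "tc_lang P S R = {z. \<exists>ts. valid P (Inner S ts) \<and> yield (Inner S ts) = z
       \<and> (\<forall>j < height (Inner S ts). level (Inner S ts) j \<in> R)}"

definition TC :: "'t sym list set set \<Rightarrow> 't list set set" where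
  "TC \<F> = {L. \<exists>N T P S R. tc_grammar N T P S R \<and> R \<in> \<F> \<and> L = tc_lang P S R}"

definition cs_grammar :: "nat set \<Rightarrow> 't set \<Rightarrow> ('t sym list \<times> 't sym list) set \<Rightarrow> nat \<Rightarrow> bool" where
  "cs_grammar N T P S \<longleftrightarrow> finite N \<and> finite T \<and> finite P \<and> S \<in> N
     \<and> (\<forall>(l, r) \<in> P. set l \<subseteq> syms N T \<and> set r \<subseteq> syms N T)
     \<and> (\<forall>(l, r) \<in> P.
          (\<exists>u1 A u2 x. l = u1 @ [Nt A] @ u2 \<and> r = u1 @ x @ u2 \<and> x \<noteq> [])
        \<or> (l = [Nt S] \<and> r = [] \<and> (\<forall>(l', r') \<in> P. Nt S \<notin> set r')))"

definition step :: "('t sym list \<times> 't sym list) set \<Rightarrow> 't sym list \<Rightarrow> 't sym list \<Rightarrow> bool" where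
  "step P u v \<longleftrightarrow> (\<exists>x y l r. (l, r) \<in> P \<and> u = x @ l @ y \<and> v = x @ r @ y)"

definition cs_lang :: "('t sym list \<times> 't sym list) set \<Rightarrow> nat \<Rightarrow> 't list set" where
  "cs_lang P S = {z. (step P)\<^sup>*\<^sup>* [Nt S] (map Tm z)}"

definition CS :: "'t list set set" where
  "CS = {L. \<exists>N T P S. cs_grammar N T P S \<and> L = cs_lang P S}"

end

(* Tree-controlled to context-sensitive: the levels of a derivation tree form a sequence of words
   obtained from each other by rewriting all letters in parallel, where terminals drop out of the level
   word but keep their place in the yield. A head sweeps over such a word from left to right, simulates an
   automaton for the control language on the level word and rewrites it to the next one, and returns to the
   left end; no letter is ever deleted, so a grammar with rules c -> w and ab -> cd suffices, and each rule
   ab -> cd is split into rules that rewrite one letter in context.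

   Context-sensitive to tree-controlled: to apply l -> r, one parallel step turns each letter l_i of an
   occurrence of l into a mark (l, r, i), and the next one turns the marks into r. The control language
   only has to ensure that the marks of an occurrence stand next to each other in the right order, which is
   a condition on pairs of adjacent letters and on the (flagged) first and last letter. Terminals are
   represented by nonterminals and are not allowed in the control language, hence they can appear in the
   last level only. *)
theory Submission
  imports Defs
begin

section \<open>Derivation trees as parallel rewriting\<close>

text \<open>Erasure is kept out of both simulations. An erasable axiom occurs on no right-hand side,
  so the erasing rule can act only on the initial word, and each language is that of the nonerasing
  rules plus possibly the empty word. This is also what lets a head live inside the word: every
  replacement has a letter for it to stand on. The verdict of the automaton comes only at the right
  end, when the word has already been rewritten. Rejection merely leaves the head stuck, and a
  letter carrying a head in mid-sweep has no terminal image. A mark carries its whole rule, so that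
  adjacency alone can tie it to its block. Many blocks may be rewritten in the same level; complete
  blocks are disjoint, so their rules can be applied one after another. The end flags replace
  conditions on prefixes and suffixes: what remains is a condition on letters and adjacent pairs,
  which windows of any length \<open>k \<ge> 2\<close> can express uniformly.\<close>

text \<open>A configuration is the current level word (flag \<^const>\<open>True\<close>) interleaved with the terminals
  of earlier levels (flag \<^const>\<open>False\<close>).\<close>

definition active :: "('t sym \<times> bool) list \<Rightarrow> 't sym list" where
  "active c = map fst (filter snd c)"

text \<open>A terminal is frozen whatever its flag, since a leaf contributes to no level below its
  own. A nonterminal with flag \<open>False\<close> has no step; none arises from the axiom.\<close>

inductive letter_step :: "(nat \<times> 't sym list) set \<Rightarrow> 't sym \<times> bool \<Rightarrow> ('t sym \<times> bool) list \<Rightarrow> bool"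
  for P where
  freeze: "letter_step P (Tm a, b) [(Tm a, False)]"
| expand: "(A, w) \<in> P \<Longrightarrow> letter_step P (Nt A, True) (map (\<lambda>x. (x, True)) w)"

definition rewrite_all ::
  "(nat \<times> 't sym list) set \<Rightarrow> ('t sym \<times> bool) list \<Rightarrow> ('t sym \<times> bool) list \<Rightarrow> bool" where
  "rewrite_all P c d \<longleftrightarrow> (\<exists>ds. list_all2 (letter_step P) c ds \<and> d = concat ds)"

definition par_step ::
  "(nat \<times> 't sym list) set \<Rightarrow> 't sym list set \<Rightarrow> ('t sym \<times> bool) list \<Rightarrow> ('t sym \<times> bool) list \<Rightarrow> bool"
  where "par_step P R c d \<longleftrightarrow> active c \<in> R \<and> rewrite_all P c d"

lemma active_simps [simp]:
  "active [] = []"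
  "active (p # c) = (if snd p then fst p # active c else active c)"
  "active (c @ d) = active c @ active d"
  "active (map (\<lambda>x. (x, True)) w) = w"
  by (auto simp: active_def o_def filter_map)

lemma rewrite_all_Nil [simp]: "rewrite_all P [] d \<longleftrightarrow> d = []"
  by (auto simp: rewrite_all_def)

lemma rewrite_all_append:
  "rewrite_all P c d \<Longrightarrow> rewrite_all P c' d' \<Longrightarrow> rewrite_all P (c @ c') (d @ d')"
  unfolding rewrite_all_def by (metis concat_append list_all2_appendI)

lemma rewrite_all_single [simp]: "rewrite_all P [p] d \<longleftrightarrow> letter_step P p d"
  by (auto simp: rewrite_all_def list_all2_Cons1)

lemma rewrite_all_Cons:
  "rewrite_all P (p # c) d \<longleftrightarrow> (\<exists>d1 d2. d = d1 @ d2 \<and> letter_step P p d1 \<and> rewrite_all P c d2)"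
proof
  assume "rewrite_all P (p # c) d"
  then obtain d1 ds where "letter_step P p d1" "list_all2 (letter_step P) c ds" "d = d1 @ concat ds"
    by (auto simp: rewrite_all_def list_all2_Cons1)
  then show "\<exists>d1 d2. d = d1 @ d2 \<and> letter_step P p d1 \<and> rewrite_all P c d2"
    unfolding rewrite_all_def by blast
next
  assume "\<exists>d1 d2. d = d1 @ d2 \<and> letter_step P p d1 \<and> rewrite_all P c d2"
  then show "rewrite_all P (p # c) d"
    using rewrite_all_append[of P "[p]" _ c] by auto
qed

lemma rewrite_all_concat:
  "(\<And>s. s \<in> set ts \<Longrightarrow> rewrite_all P (f s) (g s)) \<Longrightarrow>
   rewrite_all P (concat (map f ts)) (concat (map g ts))"
  by (induction ts) (auto intro: rewrite_all_append)

section \<open>From derivation trees to chains of parallel steps\<close>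

fun tree_config :: "'t dtree \<Rightarrow> nat \<Rightarrow> ('t sym \<times> bool) list" where
  "tree_config t 0 = map (\<lambda>x. (x, True)) (lab t)"
| "tree_config (Inner A ts) (Suc j) = concat (map (\<lambda>s. tree_config s j) ts)"
| "tree_config (Leaf a) (Suc j) = [(Tm a, False)]"
| "tree_config Lam (Suc j) = []"

lemma active_concat: "active (concat cs) = concat (map active cs)"
  by (induction cs) auto

lemma active_tree_config: "active (tree_config t j) = level t j"
proof (induction t j rule: tree_config.induct)
  case (2 A ts j)
  then show ?case by (simp add: active_concat o_def cong: map_cong)
qed simp_all

lemma rewrite_all_tree_config:
  "valid P t \<Longrightarrow> rewrite_all P (tree_config t j) (tree_config t (Suc j))"
proof (induction j arbitrary: t)
  case 0
  show ?case
  proof (cases t)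
    case (Inner A ts)
    have "concat (map (\<lambda>s. tree_config s 0) ts) = map (\<lambda>x. (x, True)) (concat (map lab ts))"
      by (simp add: map_concat o_def)
    then show ?thesis using 0 Inner letter_step.expand[of A "concat (map lab ts)" P] by auto
  qed (auto intro: letter_step.freeze)
next
  case (Suc j)
  show ?case
  proof (cases t)
    case (Inner A ts)
    then show ?thesis using Suc by (auto intro!: rewrite_all_concat)
  qed (auto intro: letter_step.freeze)
qed

lemma foldr_max_le: "foldr max (map f xs) 0 \<le> (n::nat) \<longleftrightarrow> (\<forall>x\<in>set xs. f x \<le> n)"
  by (induction xs) auto

text \<open>From depth \<open>height t\<close> on no inner node is left, so every letter is a leaf,
  either still active or frozen.\<close>

lemma tree_config_height:
  "height t \<le> j \<Longrightarrow> map fst (tree_config t j) = map Tm (yield t)"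
proof (induction t j rule: tree_config.induct)
  case (1 t)
  then show ?case by (cases t) auto
next
  case (2 A ts j)
  then have "map (\<lambda>s. map fst (tree_config s j)) ts = map (\<lambda>s. map Tm (yield s)) ts"
    by (auto simp: foldr_max_le)
  then show ?case by (simp add: map_concat o_def del: map_eq_conv)
qed simp_all

section \<open>From chains of parallel steps back to derivation trees\<close>

definition forest_level :: "('t sym \<times> bool) list \<Rightarrow> 't dtree list \<Rightarrow> nat \<Rightarrow> 't sym list" where
  "forest_level c ts j = concat (map (\<lambda>(p, t). if snd p then level t j else []) (zip c ts))"

text \<open>The trees of a forest differ in height, and a leaf can wait through any number of steps;
  hence \<open>n\<close> is only an upper bound.\<close>

definition fits :: "(nat \<times> 't sym list) set \<Rightarrow> nat \<Rightarrow> 't sym \<times> bool \<Rightarrow> 't dtree \<Rightarrow> bool" where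
  "fits P n p t \<longleftrightarrow> lab t = [fst p] \<and> valid P t \<and> height t \<le> n"

lemma forest_level_simps [simp]:
  "forest_level [] ts j = []"
  "forest_level (p # c) (t # ts) j = (if snd p then level t j else []) @ forest_level c ts j"
  by (auto simp: forest_level_def)

lemma forest_level_append:
  "length c = length ts \<Longrightarrow> forest_level (c @ d) (ts @ us) j = forest_level c ts j @ forest_level d us j"
  by (simp add: forest_level_def)

lemma forest_level_active:
  "length w = length ts \<Longrightarrow> forest_level (map (\<lambda>x. (x, True)) w) ts j = concat (map (\<lambda>t. level t j) ts)"
  by (induction w ts rule: list_induct2) auto

lemma level_Lam: "level Lam j = []"
  by (cases j) auto

text \<open>One node is put on top of the trees grown from its replacement. A frozen terminal reuses
  its leaf, and an empty replacement becomes the single child \<open>Lam\<close>.\<close>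

lemma fits_root:
  assumes "letter_step P p d" and "list_all2 (fits P n) d ts"
  shows "\<exists>u. fits P (Suc n) p u \<and> yield u = concat (map yield ts)
     \<and> (snd p \<longrightarrow> level u 0 = [fst p])
     \<and> (\<forall>j. (if snd p then level u (Suc j) else []) = forest_level d ts j)"
  using assms(1)
proof cases
  case (freeze a b)
  then obtain t where t: "ts = [t]" "lab t = [Tm a]"
    using assms(2) by (auto simp: list_all2_Cons1 fits_def)
  then have "t = Leaf a" by (cases t) auto
  then show ?thesis using freeze t by (intro exI[of _ "Leaf a"]) (auto simp: fits_def)
next
  case (expand A w)
  have len: "length w = length ts" and lab: "concat (map lab ts) = w"
    and ok: "\<forall>t\<in>set ts. valid P t \<and> height t \<le> n \<and> t \<noteq> Lam"
  proof -
    have "list_all2 (\<lambda>x. fits P n (x, True)) w ts"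
      using assms(2) expand by (simp add: list_all2_map1)
    then show "length w = length ts" "concat (map lab ts) = w"
      "\<forall>t\<in>set ts. valid P t \<and> height t \<le> n \<and> t \<noteq> Lam"
      by (induction w ts rule: list_all2_induct) (auto simp: fits_def)
  qed
  show ?thesis
  proof (cases "w = []")
    case True
    then show ?thesis using expand len by (intro exI[of _ "Inner A [Lam]"]) (auto simp: fits_def level_Lam)
  next
    case False
    then show ?thesis using expand len lab ok
      by (intro exI[of _ "Inner A ts"]) (auto simp: fits_def foldr_max_le forest_level_active)
  qed
qed

lemma fits_forest:
  assumes "list_all2 (letter_step P) c ds" and "list_all2 (fits P n) (concat ds) ts"
  shows "\<exists>us. list_all2 (fits P (Suc n)) c us \<and> concat (map yield us) = concat (map yield ts)
     \<and> forest_level c us 0 = active c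
     \<and> (\<forall>j. forest_level c us (Suc j) = forest_level (concat ds) ts j)"
  using assms
proof (induction c ds arbitrary: ts rule: list_all2_induct)
  case Nil
  then show ?case by auto
next
  case (Cons p c d ds)
  from Cons.prems obtain ts1 ts2 where ts: "ts = ts1 @ ts2"
    and 1: "list_all2 (fits P n) d ts1" and 2: "list_all2 (fits P n) (concat ds) ts2"
    by (auto simp: list_all2_append1)
  obtain u where u: "fits P (Suc n) p u" "yield u = concat (map yield ts1)"
    "snd p \<longrightarrow> level u 0 = [fst p]"
    "\<And>j. (if snd p then level u (Suc j) else []) = forest_level d ts1 j"
    using fits_root[OF Cons.hyps(1) 1] by blast
  obtain us where us: "list_all2 (fits P (Suc n)) c us"
    "concat (map yield us) = concat (map yield ts2)"
    "forest_level c us 0 = active c"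
    "\<And>j. forest_level c us (Suc j) = forest_level (concat ds) ts2 j"
    using Cons.IH[OF 2] by blast
  have "forest_level (p # c) (u # us) (Suc j) = forest_level (concat (d # ds)) ts j" for j
    unfolding forest_level_simps u(4) us(4) ts concat.simps
    using list_all2_lengthD[OF 1] by (simp add: forest_level_append)
  then show ?case using u us ts
    by (intro exI[of _ "u # us"]) auto
qed

text \<open>Trees grow from the bottom: the rest of the chain gives a forest, and the first step
  adds one layer above it. Control of the levels below \<open>n\<close> suffices, because all
  heights are at most \<open>n\<close>.\<close>

lemma forest_of_chain:
  assumes "(par_step P R ^^ n) c d" and "map fst d = map Tm z"
  shows "\<exists>ts. list_all2 (fits P n) c ts \<and> concat (map yield ts) = z \<and> (\<forall>j<n. forest_level c ts j \<in> R)"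
  using assms(1)
proof (induction n arbitrary: c)
  case 0
  have "list_all2 (fits P 0) d (map Leaf z)"
    using assms(2) by (induction d arbitrary: z) (auto simp: fits_def)
  moreover have "concat (map yield (map Leaf z)) = z" by (induction z) auto
  ultimately show ?case using 0 by auto
next
  case (Suc n)
  obtain c' where c': "par_step P R c c'" "(par_step P R ^^ n) c' d"
    using Suc.prems relpowp_Suc_D2 by metis
  obtain ts where ts: "list_all2 (fits P n) c' ts" "concat (map yield ts) = z"
    "\<forall>j<n. forest_level c' ts j \<in> R" using Suc.IH[OF c'(2)] by blast
  obtain ds where ds: "list_all2 (letter_step P) c ds" "c' = concat ds" "active c \<in> R"
    using c'(1) by (auto simp: par_step_def rewrite_all_def)
  obtain us where us: "list_all2 (fits P (Suc n)) c us"
    "concat (map yield us) = concat (map yield ts)" "forest_level c us 0 = active c"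
    "\<forall>j. forest_level c us (Suc j) = forest_level (concat ds) ts j"
    using fits_forest[OF ds(1)] ts(1) ds(2) by blast
  have "forest_level c us j \<in> R" if "j < Suc n" for j
    using that us ts ds by (cases j) auto
  then show ?case using us ts by auto
qed

lemma tc_lang_par_step:
  "tc_lang P S R = {z. \<exists>c. (par_step P R)\<^sup>*\<^sup>* [(Nt S, True)] c \<and> map fst c = map Tm z}"
proof (intro set_eqI iffI)
  fix z assume "z \<in> tc_lang P S R"
  then obtain ts where ts: "valid P (Inner S ts)" "yield (Inner S ts) = z"
    "\<forall>j < height (Inner S ts). level (Inner S ts) j \<in> R" by (auto simp: tc_lang_def)
  have "j \<le> height (Inner S ts) \<Longrightarrow>
    (par_step P R)\<^sup>*\<^sup>* [(Nt S, True)] (tree_config (Inner S ts) j)" for j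
  proof (induction j)
    case (Suc j)
    then have "par_step P R (tree_config (Inner S ts) j) (tree_config (Inner S ts) (Suc j))"
      using ts rewrite_all_tree_config[OF ts(1)] by (simp add: par_step_def active_tree_config)
    then show ?case using Suc by auto
  qed auto
  then show "z \<in> {z. \<exists>c. (par_step P R)\<^sup>*\<^sup>* [(Nt S, True)] c \<and> map fst c = map Tm z}"
    using tree_config_height[of "Inner S ts" "height (Inner S ts)"] ts(2) by blast
next
  fix z assume "z \<in> {z. \<exists>c. (par_step P R)\<^sup>*\<^sup>* [(Nt S, True)] c \<and> map fst c = map Tm z}"
  then obtain c where "(par_step P R)\<^sup>*\<^sup>* [(Nt S, True)] c" and z: "map fst c = map Tm z" by auto
  then obtain n where "(par_step P R ^^ n) [(Nt S, True)] c" using rtranclp_imp_relpowp by metis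
  from forest_of_chain[OF this z] obtain t where t: "fits P n (Nt S, True) t" "yield t = z"
    "\<forall>j<n. level t j \<in> R" by (auto simp: list_all2_Cons1)
  obtain ts where "t = Inner S ts" using t(1) by (cases t) (auto simp: fits_def)
  then show "z \<in> tc_lang P S R" using t by (auto simp: tc_lang_def fits_def intro!: exI[of _ ts])
qed

section \<open>Setting the erasing rule of the axiom aside\<close>

definition nonerasing :: "('a \<times> 'b list) set \<Rightarrow> ('a \<times> 'b list) set" where
  "nonerasing P = {p \<in> P. snd p \<noteq> []}"

lemma letter_step_mono: "letter_step P p d \<Longrightarrow> P \<subseteq> Q \<Longrightarrow> letter_step Q p d"
  by (induction rule: letter_step.induct) (auto intro: letter_step.intros)

lemma par_step_mono: "par_step P R c d \<Longrightarrow> P \<subseteq> Q \<Longrightarrow> par_step Q R c d"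
  unfolding par_step_def rewrite_all_def by (metis letter_step_mono list_all2_mono)

text \<open>If the axiom is erasable and absent, no right-hand side brings it back, so the erasing
  rule never gets a letter to act on.\<close>

lemma rewrite_all_nonerasing:
  assumes cf: "cf_grammar N T P S"
    and "rewrite_all P c d" and "(S, []) \<in> P \<longrightarrow> Nt S \<notin> fst ` set c"
  shows "rewrite_all (nonerasing P) c d \<and> ((S, []) \<in> P \<longrightarrow> Nt S \<notin> fst ` set d)"
  using assms(2,3)
proof (induction c arbitrary: d)
  case Nil
  then show ?case by simp
next
  case (Cons p c)
  then obtain d1 d2 where d: "d = d1 @ d2" "letter_step P p d1" "rewrite_all P c d2"
    by (auto simp: rewrite_all_Cons)
  have "letter_step (nonerasing P) p d1 \<and> ((S, []) \<in> P \<longrightarrow> Nt S \<notin> fst ` set d1)"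
    using d(2)
  proof cases
    case (freeze a b)
    then show ?thesis by (auto intro: letter_step.intros)
  next
    case (expand A w)
    then have "w \<noteq> []" using cf Cons.prems(2) by (fastforce simp: cf_grammar_def)
    moreover have "(S, []) \<in> P \<longrightarrow> Nt S \<notin> set w"
      using cf expand by (fastforce simp: cf_grammar_def)
    ultimately show ?thesis using expand letter_step.expand[of A w "nonerasing P"]
      by (auto simp: nonerasing_def)
  qed
  moreover have "rewrite_all (nonerasing P) c d2 \<and> ((S, []) \<in> P \<longrightarrow> Nt S \<notin> fst ` set d2)"
    using Cons.IH[OF d(3)] Cons.prems(2) by auto
  ultimately show ?case using d(1) by (auto simp: rewrite_all_Cons)
qed

text \<open>The axiom can be erased only at the root, because it does not occur on right-hand sides.\<close>

lemma chain_nonerasing: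
  assumes cf: "cf_grammar N T P S"
    and "(par_step P R)\<^sup>*\<^sup>* [(Nt S, True)] c"
  shows "(c = [] \<and> (S, []) \<in> P \<and> [Nt S] \<in> R) \<or>
    ((par_step (nonerasing P) R)\<^sup>*\<^sup>* [(Nt S, True)] c
      \<and> ((S, []) \<in> P \<longrightarrow> c = [(Nt S, True)] \<or> Nt S \<notin> fst ` set c))"
  using assms(2)
proof (induction rule: rtranclp_induct)
  case base
  then show ?case by auto
next
  case (step c d)
  have act: "active c \<in> R" and all: "rewrite_all P c d"
    using step.hyps by (auto simp: par_step_def)
  from step.IH consider "c = []" "(S, []) \<in> P" "[Nt S] \<in> R"
    | "c = [(Nt S, True)]"
    | "(par_step (nonerasing P) R)\<^sup>*\<^sup>* [(Nt S, True)] c" "(S, []) \<in> P \<longrightarrow> Nt S \<notin> fst ` set c"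
    by blast
  then show ?case
  proof cases
    case 1
    then show ?thesis using all by simp
  next
    case 2
    then obtain w where w: "(S, w) \<in> P" "d = map (\<lambda>x. (x, True)) w"
      using all by (auto simp: letter_step.simps)
    show ?thesis
    proof (cases "w = []")
      case True
      then show ?thesis using w act 2 by simp
    next
      case False
      then have "letter_step (nonerasing P) (Nt S, True) d"
        using w letter_step.expand[of S w "nonerasing P"] by (simp add: nonerasing_def)
      then have "par_step (nonerasing P) R [(Nt S, True)] d"
        using act 2 by (simp add: par_step_def)
      moreover have "(S, []) \<in> P \<longrightarrow> Nt S \<notin> fst ` set d"
        using cf w by (fastforce simp: cf_grammar_def)
      ultimately show ?thesis by blast
    qed
  next
    case 3
    have "par_step (nonerasing P) R c d" "(S, []) \<in> P \<longrightarrow> Nt S \<notin> fst ` set d"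
      using rewrite_all_nonerasing[OF cf all] 3(2) act by (auto simp: par_step_def)
    then show ?thesis using rtranclp.rtrancl_into_rtrancl[OF 3(1)] by blast
  qed
qed

text \<open>The condition \<open>[Nt S] \<in> R\<close> is the control of level 0 in the tree that
  erases the axiom at once.\<close>

lemma tc_lang_erasing:
  assumes "cf_grammar N T P S"
  shows "tc_lang P S R = tc_lang (nonerasing P) S R \<union> {z. z = [] \<and> (S, []) \<in> P \<and> [Nt S] \<in> R}"
proof (intro set_eqI iffI)
  fix z assume "z \<in> tc_lang P S R"
  then obtain c where "(par_step P R)\<^sup>*\<^sup>* [(Nt S, True)] c" and z: "map fst c = map Tm z"
    by (auto simp: tc_lang_par_step)
  then show "z \<in> tc_lang (nonerasing P) S R \<union> {z. z = [] \<and> (S, []) \<in> P \<and> [Nt S] \<in> R}"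
    using chain_nonerasing[OF assms, of R c] z unfolding tc_lang_par_step by fastforce
next
  fix z assume z: "z \<in> tc_lang (nonerasing P) S R \<union> {z. z = [] \<and> (S, []) \<in> P \<and> [Nt S] \<in> R}"
  show "z \<in> tc_lang P S R"
  proof (cases "z = [] \<and> (S, []) \<in> P \<and> [Nt S] \<in> R")
    case True
    then have "par_step P R [(Nt S, True)] []"
      using letter_step.expand[of S "[]" P] by (simp add: par_step_def)
    then have "(par_step P R)\<^sup>*\<^sup>* [(Nt S, True)] []" by (rule r_into_rtranclp)
    moreover have "map fst [] = map Tm z" using True by simp
    ultimately show ?thesis unfolding tc_lang_par_step by blast
  next
    case False
    have "par_step (nonerasing P) R \<le> par_step P R"
      by (intro predicate2I) (rule par_step_mono, auto simp: nonerasing_def)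
    then have "(par_step (nonerasing P) R)\<^sup>*\<^sup>* \<le> (par_step P R)\<^sup>*\<^sup>*" by (rule rtranclp_mono)
    then show ?thesis using False z unfolding tc_lang_par_step by blast
  qed
qed

section \<open>Strictly locally testable languages\<close>

definition pair_lang :: "'a set \<Rightarrow> ('a \<Rightarrow> 'a \<Rightarrow> bool) \<Rightarrow> 'a list set" where
  "pair_lang V D = {w. set w \<subseteq> V \<and> successively D w}"

text \<open>One set of windows serves as \<open>B\<close>, \<open>I\<close> and \<open>E\<close>:
  since \<open>k \<ge> 2\<close>, every adjacent pair of a long word lies in some window. Words
  shorter than \<open>k\<close> are put into \<open>F\<close>.\<close>

lemma pair_lang_SLT_k:
  assumes "finite V" and "k \<ge> 2"
  shows "pair_lang V D \<in> SLT_k k"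
proof -
  let ?B = "{w \<in> pair_lang V D. length w = k}"
  let ?F = "{w \<in> pair_lang V D. length w \<le> k - 1}"
  have "w \<in> pair_lang V D \<longleftrightarrow> w \<in> slt k V ?B ?B ?B ?F" for w
  proof (cases "length w \<ge> k")
    case False
    then show ?thesis using \<open>k \<ge> 2\<close> by (auto simp: slt_def pair_lang_def)
  next
    case True
    have win: "successively D w \<longleftrightarrow> (\<forall>j. j + k \<le> length w \<longrightarrow> successively D (take k (drop j w)))"
    proof (intro iffI allI impI)
      fix j assume "successively D w" "j + k \<le> length w"
      then show "successively D (take k (drop j w))" by (auto simp: successively_conv_nth)
    next
      assume *: "\<forall>j. j + k \<le> length w \<longrightarrow> successively D (take k (drop j w))"
      show "successively D w"
        unfolding successively_conv_nth
      proof (intro allI impI)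
        fix i assume i: "Suc i < length w"
        \<comment> \<open>The window starting at \<open>i\<close> contains both letters unless it
          would stick out on the right; then the last window contains them.\<close>
        define j where "j = min i (length w - k)"
        have j: "j + k \<le> length w" "Suc (i - j) < k" "j \<le> i"
          using i True \<open>k \<ge> 2\<close> by (auto simp: j_def)
        have "successively D (take k (drop j w))" using * j(1) by blast
        then have "Suc (i - j) < length (take k (drop j w)) \<Longrightarrow>
            D (take k (drop j w) ! (i - j)) (take k (drop j w) ! Suc (i - j))"
          unfolding successively_conv_nth by blast
        moreover have "j + (i - j) = i" using j by simp
        ultimately show "D (w ! i) (w ! Suc i)"
          using j nth_take[of "Suc (i - j)" k "drop j w"] by (simp del: le_add_diff_inverse)
      qed
    qed
    have sub: "set (take k (drop j w)) \<subseteq> V" if "set w \<subseteq> V" for j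
      using that by (meson order_trans set_drop_subset set_take_subset)
    \<comment> \<open>The bound \<open>j + k + 1\<close> in \<open>slt\<close> leaves out the last
      window, so the first, inner and last windows together are all windows.\<close>
    have split: "j + k \<le> length w \<longleftrightarrow> j = 0 \<or> (1 \<le> j \<and> j + k + 1 \<le> length w) \<or> j = length w - k" for j
      using True by auto
    have last: "drop (length w - k) w = take k (drop (length w - k) w)" using True by simp
    have "w \<in> slt k V ?B ?B ?B ?F \<longleftrightarrow> set w \<subseteq> V \<and>
      (\<forall>j. j + k \<le> length w \<longrightarrow> take k (drop j w) \<in> ?B)"
      unfolding split using True \<open>k \<ge> 2\<close> last by (auto simp: slt_def)
    also have "\<dots> \<longleftrightarrow> w \<in> pair_lang V D"
      using win sub by (auto simp: pair_lang_def)
    finally show ?thesis by simp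
  qed
  then have eq: "pair_lang V D = slt k V ?B ?B ?B ?F" by blast
  have "?B \<subseteq> {w. set w \<subseteq> V \<and> length w = k}" "?F \<subseteq> {w. set w \<subseteq> V \<and> length w \<le> k - 1}"
    by (auto simp: pair_lang_def)
  then show ?thesis unfolding SLT_k_def using \<open>finite V\<close> eq by blast
qed

section \<open>Automata for strictly locally testable languages\<close>

definition recognises ::
  "'q set \<Rightarrow> ('q \<Rightarrow> 'a \<Rightarrow> 'q) \<Rightarrow> 'q \<Rightarrow> ('q \<Rightarrow> bool) \<Rightarrow> 'a set \<Rightarrow> 'a list set \<Rightarrow> bool" where
  "recognises Q \<delta> q0 acc \<Sigma> R \<longleftrightarrow> finite Q \<and> q0 \<in> Q \<and> (\<forall>q\<in>Q. \<forall>a\<in>\<Sigma>. \<delta> q a \<in> Q)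
     \<and> (\<forall>w. set w \<subseteq> \<Sigma> \<longrightarrow> (w \<in> R \<longleftrightarrow> acc (foldl \<delta> q0 w)))"

text \<open>A state consists of the last \<open>k\<close> letters read, whether more than \<open>k\<close> letters have been read,
  and whether every window except the last one is permitted.\<close>

lemma slt_recognises:
  fixes R :: "'a list set"
  assumes "R \<in> SLT_k k" and "k \<ge> 1" and "finite \<Sigma>"
  shows "\<exists>(Q :: ('a list \<times> bool \<times> bool) set) \<delta> q0 acc. recognises Q \<delta> q0 acc \<Sigma> R"
proof -
  obtain V B I E F where
    sub: "B \<subseteq> {w. set w \<subseteq> V \<and> length w = k}" "I \<subseteq> {w. set w \<subseteq> V \<and> length w = k}"
      "E \<subseteq> {w. set w \<subseteq> V \<and> length w = k}" "F \<subseteq> {w. set w \<subseteq> V \<and> length w \<le> k - 1}"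
    and R: "R = slt k V B I E F"
    using assms(1) by (auto simp: SLT_k_def)
  \<comment> \<open>A full window followed by another letter is not the last one, so it can be
    tested now: against \<open>B\<close> if it is the first, against \<open>I\<close>
    otherwise.\<close>
  define \<delta> where "\<delta> = (\<lambda>(s, g, ok) a. if length s < k then (s @ [a], False, ok \<and> a \<in> V)
      else (tl s @ [a], True, ok \<and> a \<in> V \<and> s \<in> (if g then I else B)))"
  \<comment> \<open>After exactly \<open>k\<close> letters \<open>g\<close> is still
    \<open>False\<close>, and the only window has to lie in both \<open>B\<close> and
    \<open>E\<close>.\<close>
  define acc where "acc = (\<lambda>(s, g, ok). ok \<and> (if length s < k then s \<in> F else s \<in> E \<and> (g \<or> s \<in> B)))"
  define \<sigma> where "\<sigma> w = (drop (length w - k) w, length w > k, set w \<subseteq> V \<and>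
      (length w > k \<longrightarrow> take k w \<in> B \<and> (\<forall>j. 1 \<le> j \<and> j + k + 1 \<le> length w \<longrightarrow> take k (drop j w) \<in> I)))"
    for w
  define Q where "Q = {s. set s \<subseteq> \<Sigma> \<and> length s \<le> k} \<times> (UNIV :: bool set) \<times> (UNIV :: bool set)"
  have run: "foldl \<delta> ([], False, True) w = \<sigma> w" for w
  proof (induction w rule: rev_induct)
    case Nil
    then show ?case by (simp add: \<sigma>_def)
  next
    case (snoc a w)
    have "\<delta> (\<sigma> w) a = \<sigma> (w @ [a])"
    proof (cases "length w < k")
      case True
      then show ?thesis by (auto simp: \<sigma>_def \<delta>_def)
    next
      case False
      let ?s = "drop (length w - k) w"
      have s: "length ?s = k" "tl ?s @ [a] = drop (Suc (length w) - k) (w @ [a])"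
        using False \<open>k \<ge> 1\<close> by (auto simp: drop_Suc tl_drop Suc_diff_le tl_append split: list.split)
      \<comment> \<open>The new letter turns the former last window into an inner one, unless that
        window is also the first.\<close>
      have "(\<forall>j. 1 \<le> j \<and> j + k + 1 \<le> Suc (length w) \<longrightarrow> take k (drop j (w @ [a])) \<in> I)
        \<longleftrightarrow> (\<forall>j. 1 \<le> j \<and> j + k + 1 \<le> length w \<longrightarrow> take k (drop j w) \<in> I) \<and> (length w > k \<longrightarrow> ?s \<in> I)"
        (is "?l \<longleftrightarrow> ?r")
      proof -
        have 1: "(1 \<le> j \<and> j + k + 1 \<le> Suc (length w)) \<longleftrightarrow>
          (1 \<le> j \<and> j + k + 1 \<le> length w) \<or> (length w > k \<and> j = length w - k)" for j
          using False by auto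
        have 2: "take k (drop j (w @ [a])) = take k (drop j w)" if "j + k \<le> length w" for j
          using that by simp
        have 3: "?s = take k ?s" using s by simp
        have "?l \<longleftrightarrow> (\<forall>j. (1 \<le> j \<and> j + k + 1 \<le> length w) \<or> (length w > k \<and> j = length w - k)
            \<longrightarrow> take k (drop j w) \<in> I)"
          unfolding 1 using 2 False by (metis 1 Suc_eq_plus1 Suc_le_mono)
        also have "\<dots> \<longleftrightarrow> ?r" using 3 by auto
        finally show ?thesis .
      qed
      moreover have "take k (w @ [a]) = take k w" "length w = k \<Longrightarrow> ?s = take k w" using False by auto
      ultimately show ?thesis using False s by (auto simp: \<sigma>_def \<delta>_def)
    qed
    then show ?case using snoc by simp
  qed
  have "acc (\<sigma> w) \<longleftrightarrow> w \<in> R" for w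
  proof (cases "length w < k")
    case True
    then show ?thesis using sub(4) by (auto simp: acc_def \<sigma>_def R slt_def)
  next
    case False
    then have "w \<notin> F" using sub(4) \<open>k \<ge> 1\<close> by auto
    moreover have "length w = k \<or> length w > k" using False by auto
    ultimately show ?thesis by (auto simp: acc_def \<sigma>_def R slt_def)
  qed
  moreover have "finite Q"
    unfolding Q_def using finite_lists_length_le[OF \<open>finite \<Sigma>\<close>, of k] by simp
  moreover have "set (tl s) \<subseteq> set s" for s :: "'a list" by (cases s) auto
  then have "\<delta> q a \<in> Q" if "q \<in> Q" "a \<in> \<Sigma>" for q a
    using that \<open>k \<ge> 1\<close> by (fastforce simp: Q_def \<delta>_def)
  ultimately have "recognises Q \<delta> ([], False, True) acc \<Sigma> R"
    unfolding recognises_def run by (auto simp: Q_def)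
  then show ?thesis by blast
qed

section \<open>String rewriting with unary and binary rules\<close>

text \<open>The relation \<open>step\<close> over an arbitrary type of letters, so that heads and
  split symbols need not be coded as grammar symbols before the grammar is built.\<close>

definition rewrite :: "('g list \<times> 'g list) set \<Rightarrow> 'g list \<Rightarrow> 'g list \<Rightarrow> bool" where
  "rewrite P u v \<longleftrightarrow> (\<exists>x y l r. (l, r) \<in> P \<and> u = x @ l @ y \<and> v = x @ r @ y)"

lemma step_eq_rewrite: "step P = rewrite P"
  by (intro ext) (simp add: step_def rewrite_def)

lemma rewriteI: "(l, r) \<in> P \<Longrightarrow> rewrite P (x @ l @ y) (x @ r @ y)"
  unfolding rewrite_def by blast

lemma rewrite_context: "rewrite P u v \<Longrightarrow> rewrite P (x @ u @ y) (x @ v @ y)"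
  unfolding rewrite_def by (metis append.assoc)

lemma rewrites_context: "(rewrite P)\<^sup>*\<^sup>* u v \<Longrightarrow> (rewrite P)\<^sup>*\<^sup>* (x @ u @ y) (x @ v @ y)"
  by (induction rule: rtranclp_induct) (auto intro: rewrite_context rtranclp.rtrancl_into_rtrancl)

lemma rewrites_append:
  assumes "(rewrite P)\<^sup>*\<^sup>* u v" and "(rewrite P)\<^sup>*\<^sup>* u' v'"
  shows "(rewrite P)\<^sup>*\<^sup>* (u @ u') (v @ v')"
  using rewrites_context[OF assms(1), of "[]" u'] rewrites_context[OF assms(2), of v "[]"] by auto

section \<open>Binary rules split into context-sensitive ones\<close>

definition unary_or_binary :: "'g set \<Rightarrow> ('g list \<times> 'g list) set \<Rightarrow> bool" where
  "unary_or_binary \<Gamma> P \<longleftrightarrow> finite \<Gamma> \<and> finite P \<and> (\<forall>(l, r) \<in> P. set l \<subseteq> \<Gamma> \<and> set r \<subseteq> \<Gamma> \<and>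
     ((\<exists>c. l = [c] \<and> r \<noteq> []) \<or> (\<exists>a b c d. l = [a, b] \<and> r = [c, d])))"

text \<open>Both halves carry the complete rule, so that halves of different rules never count as a
  pair. \<open>Init\<close> is reserved for the axiom of the final grammar.\<close>

datatype 'g split_symbol = Init | Plain 'g | Fst 'g 'g 'g 'g | Snd 'g 'g 'g 'g

text \<open>A pair \<open>Fst a b c d\<close>, \<open>Snd a b c d\<close> counts as already rewritten to \<open>c\<close>, \<open>d\<close>;
  an isolated \<open>Fst a b c d\<close> still stands for \<open>a\<close>.\<close>

fun contract :: "'g split_symbol list \<Rightarrow> 'g list" where
  "contract [] = []"
| "contract (Init # m) = contract m"
| "contract (Plain c # m) = c # contract m"
| "contract (Fst a b c d # m) = (if m \<noteq> [] \<and> hd m = Snd a b c d then c else a) # contract m"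
| "contract (Snd a b c d # m) = d # contract m"

definition starts_block :: "'g split_symbol list \<Rightarrow> bool" where
  "starts_block m \<longleftrightarrow> (case m of [] \<Rightarrow> False | x # _ \<Rightarrow> (\<forall>a b c d. x \<noteq> Snd a b c d))"

lemma starts_block_simps [simp]:
  "\<not> starts_block []"
  "starts_block (Init # m)" "starts_block (Plain x # m)" "starts_block (Fst a b c d # m)"
  "\<not> starts_block (Snd a b c d # m)"
  by (auto simp: starts_block_def)

text \<open>Only a trailing \<open>Fst\<close> of \<open>m0\<close> looks at what follows, and only
  a \<open>Snd\<close> there affects it. The prefix \<open>x\<close> is the same for all
  \<open>m\<close>, so the left context can be treated alike on both sides of a rule.\<close>

lemma contract_prefix: "\<exists>x. \<forall>m. starts_block m \<longrightarrow> contract (m0 @ m) = x @ contract m"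
proof (induction m0)
  case Nil
  show ?case by (intro exI[of _ "[]"]) simp
next
  case (Cons s m0)
  then obtain x where x: "\<And>m. starts_block m \<Longrightarrow> contract (m0 @ m) = x @ contract m" by blast
  have hd: "hd m \<noteq> Snd a b c d" "m \<noteq> []" if "starts_block m" for m and a b c d :: 'a
    using that by (auto simp: starts_block_def split: list.splits)
  show ?case
  proof (cases s)
    case Init
    then show ?thesis using x by (intro exI[of _ x]) simp
  next
    case (Plain e)
    then show ?thesis using x by (intro exI[of _ "e # x"]) simp
  next
    case (Fst a b c d)
    have "contract ((s # m0) @ m) = ((if m0 \<noteq> [] \<and> hd m0 = Snd a b c d then c else a) # x) @ contract m"
      if "starts_block m" for m
      using x[OF that] hd[OF that] Fst by (simp add: hd_append)
    then show ?thesis by blast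
  next
    case (Snd a b c d)
    then show ?thesis using x by (intro exI[of _ "d # x"]) simp
  qed
qed

lemma contract_Plain [simp]: "contract (map Plain w @ m) = w @ contract m"
  by (induction w) auto

inductive split_rule :: "('g list \<times> 'g list) set \<Rightarrow> 'g split_symbol list \<Rightarrow> 'g split_symbol list \<Rightarrow> bool"
  for P where
  unary: "([c], w) \<in> P \<Longrightarrow> w \<noteq> [] \<Longrightarrow> split_rule P [Plain c] (map Plain w)"
| binary1: "([a, b], [c, d]) \<in> P \<Longrightarrow> split_rule P [Plain a, Plain b] [Fst a b c d, Plain b]"
| binary2: "([a, b], [c, d]) \<in> P \<Longrightarrow> split_rule P [Fst a b c d, Plain b] [Fst a b c d, Snd a b c d]"
| binary3: "([a, b], [c, d]) \<in> P \<Longrightarrow> split_rule P [Fst a b c d, Snd a b c d] [Plain c, Snd a b c d]"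
| binary4: "([a, b], [c, d]) \<in> P \<Longrightarrow> split_rule P [Plain c, Snd a b c d] [Plain c, Plain d]"

text \<open>Only \<open>unary\<close> and \<open>binary2\<close> change the contracted word, by one
  step each. No side of a rule begins with \<open>Snd\<close>, hence a pending \<open>Fst\<close> to
  its left keeps its meaning.\<close>

lemma split_rule_sound:
  assumes "split_rule P l r"
  shows "(rewrite P)\<^sup>*\<^sup>* (contract (m @ l @ m')) (contract (m @ r @ m'))"
proof -
  obtain x where x: "\<And>n. starts_block n \<Longrightarrow> contract (m @ n) = x @ contract n"
    using contract_prefix by blast
  have blk: "starts_block (l @ m')" "starts_block (r @ m')"
    using assms by (auto simp: split_rule.simps neq_Nil_conv)
  have "contract (l @ m') = contract (r @ m') \<or>
    (\<exists>u v. (u, v) \<in> P \<and> contract (l @ m') = u @ contract m' \<and> contract (r @ m') = v @ contract m')"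
    using assms
  proof cases
    case (unary c w)
    then show ?thesis by auto
  next
    case (binary2 a b c d)
    then show ?thesis by (intro disjI2 exI[of _ "[a, b]"] exI[of _ "[c, d]"]) auto
  qed auto
  then show ?thesis
  proof (elim disjE exE conjE)
    fix u v assume "(u, v) \<in> P" "contract (l @ m') = u @ contract m'" "contract (r @ m') = v @ contract m'"
    then show ?thesis using blk x rewriteI[of u v P x "contract m'"] by auto
  qed (use blk x in auto)
qed

lemma split_rule_complete:
  assumes "rewrite P u v" and "unary_or_binary \<Gamma> P"
  shows "(rewrite {(l, r). split_rule P l r})\<^sup>*\<^sup>* (map Plain u) (map Plain v)"
proof -
  let ?P = "{(l, r). split_rule P l r}"
  obtain x y l r where lr: "(l, r) \<in> P" "u = x @ l @ y" "v = x @ r @ y"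
    using assms(1) by (auto simp: rewrite_def)
  have "(\<exists>c. l = [c] \<and> r \<noteq> []) \<or> (\<exists>a b c d. l = [a, b] \<and> r = [c, d])"
    using assms(2) lr(1) by (auto simp: unary_or_binary_def)
  then have "(rewrite ?P)\<^sup>*\<^sup>* (map Plain l) (map Plain r)"
  proof (elim disjE exE conjE)
    fix c assume "l = [c]" "r \<noteq> []"
    then have "rewrite ?P (map Plain l) (map Plain r)"
      using split_rule.unary[of c r P] lr(1) rewriteI[of "[Plain c]" "map Plain r" ?P "[]" "[]"] by auto
    then show ?thesis by auto
  next
    fix a b c d assume l: "l = [a, b]" "r = [c, d]"
    have s: "split_rule P s t \<Longrightarrow> (rewrite ?P)\<^sup>*\<^sup>* s t" for s t
      using rewriteI[of s t ?P "[]" "[]"] by auto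
    have "([a, b], [c, d]) \<in> P" using lr l by simp
    note rules = this[THEN split_rule.binary1, THEN s] this[THEN split_rule.binary2, THEN s]
      this[THEN split_rule.binary3, THEN s] this[THEN split_rule.binary4, THEN s]
    show ?thesis unfolding l list.map
      by (rule rtranclp_trans[OF rules(1) rtranclp_trans[OF rules(2) rtranclp_trans[OF rules(3) rules(4)]]])
  qed
  then show ?thesis unfolding lr(2,3) map_append by (rule rewrites_context)
qed

lemma finite_split_rules:
  assumes "finite P" shows "finite {(l, r). split_rule P l r}"
proof (rule finite_subset)
  \<comment> \<open>For a unary rule some of the indexed letters are unspecified; this is harmless,
    as the set is only an upper bound.\<close>
  define parts where "parts = (\<lambda>p :: 'a list \<times> 'a list. case p of (l, r) \<Rightarrow>
    let a = l ! 0; b = l ! 1; c = r ! 0; d = r ! 1 in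
    {([Plain a], map Plain r), ([Plain a, Plain b], [Fst a b c d, Plain b]),
     ([Fst a b c d, Plain b], [Fst a b c d, Snd a b c d]),
     ([Fst a b c d, Snd a b c d], [Plain c, Snd a b c d]),
     ([Plain c, Snd a b c d], [Plain c, Plain d])})"
  show "{(l, r). split_rule P l r} \<subseteq> (\<Union>p\<in>P. parts p)"
  proof (intro subsetI)
    fix p assume "p \<in> {(l, r). split_rule P l r}"
    then have "split_rule P (fst p) (snd p)" by auto
    then show "p \<in> (\<Union>p\<in>P. parts p)"
    proof cases
      case (unary c w)
      then have "p \<in> parts ([c], w)" by (cases p) (auto simp: parts_def Let_def)
      then show ?thesis using unary by blast
    next
      case (binary1 a b c d)
      then have "p \<in> parts ([a, b], [c, d])" by (cases p) (auto simp: parts_def Let_def)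
      then show ?thesis using binary1 by blast
    next
      case (binary2 a b c d)
      then have "p \<in> parts ([a, b], [c, d])" by (cases p) (auto simp: parts_def Let_def)
      then show ?thesis using binary2 by blast
    next
      case (binary3 a b c d)
      then have "p \<in> parts ([a, b], [c, d])" by (cases p) (auto simp: parts_def Let_def)
      then show ?thesis using binary3 by blast
    next
      case (binary4 a b c d)
      then have "p \<in> parts ([a, b], [c, d])" by (cases p) (auto simp: parts_def Let_def)
      then show ?thesis using binary4 by blast
    qed
  qed
  show "finite (\<Union>p\<in>P. parts p)" using assms by (auto simp: parts_def Let_def)
qed

lemma split_rule_symbols:
  assumes "split_rule P l r" and "unary_or_binary \<Gamma> P"
  shows "set l \<union> set r \<subseteq> Plain ` \<Gamma> \<union> (\<Union>a\<in>\<Gamma>. \<Union>b\<in>\<Gamma>. \<Union>c\<in>\<Gamma>. \<Union>d\<in>\<Gamma>. {Fst a b c d, Snd a b c d})"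
proof -
  have "set u \<subseteq> \<Gamma> \<and> set v \<subseteq> \<Gamma>" if "(u, v) \<in> P" for u v
    using assms(2) that by (auto simp: unary_or_binary_def)
  note symbols = this
  from assms(1) show ?thesis
  proof cases
    case (unary c w)
    then show ?thesis using symbols[OF unary(3)] by auto
  next
    case (binary1 a b c d)
    then show ?thesis using symbols[OF binary1(3)] by auto
  next
    case (binary2 a b c d)
    then show ?thesis using symbols[OF binary2(3)] by auto
  next
    case (binary3 a b c d)
    then show ?thesis using symbols[OF binary3(3)] by auto
  next
    case (binary4 a b c d)
    then show ?thesis using symbols[OF binary4(3)] by auto
  qed
qed

lemma split_rule_context_sensitive:
  assumes "split_rule P l r"
  shows "\<exists>u A v x. l = u @ [A] @ v \<and> r = u @ x @ v \<and> x \<noteq> []"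
  using assms
proof cases
  case (unary c w)
  then show ?thesis by (intro exI[of _ "[]"] exI[of _ "Plain c"] exI[of _ "map Plain w"]) auto
next
  case (binary1 a b c d)
  then show ?thesis
    by (intro exI[of _ "[]"] exI[of _ "Plain a"] exI[of _ "[Plain b]"] exI[of _ "[Fst a b c d]"]) auto
next
  case (binary2 a b c d)
  then show ?thesis
    by (intro exI[of _ "[Fst a b c d]"] exI[of _ "Plain b"] exI[of _ "[]"] exI[of _ "[Snd a b c d]"]) auto
next
  case (binary3 a b c d)
  then show ?thesis
    by (intro exI[of _ "[]"] exI[of _ "Fst a b c d"] exI[of _ "[Snd a b c d]"] exI[of _ "[Plain c]"]) auto
next
  case (binary4 a b c d)
  then show ?thesis
    by (intro exI[of _ "[Plain c]"] exI[of _ "Snd a b c d"] exI[of _ "[]"] exI[of _ "[Plain d]"]) auto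
qed

text \<open>The map \<open>fin\<close> gives the terminal image of a letter, if it has one. The flag
  \<open>b\<close> adds the empty word, which rewriting with nonempty right-hand sides cannot
  reach.\<close>

lemma rewriting_in_CS:
  fixes fin :: "'g \<Rightarrow> 't option"
  assumes uob: "unary_or_binary \<Gamma> P" and s: "s \<in> \<Gamma>"
  shows "{z. \<exists>w. (rewrite P)\<^sup>*\<^sup>* [s] w \<and> map fin w = map Some z} \<union> {z. z = [] \<and> b} \<in> CS"
    (is "?L \<in> CS")
proof -
  have fin\<Gamma>: "finite \<Gamma>" and finP: "finite P" using uob by (auto simp: unary_or_binary_def)
  define Q where "Q = Plain ` \<Gamma> \<union> (\<Union>a\<in>\<Gamma>. \<Union>b\<in>\<Gamma>. \<Union>c\<in>\<Gamma>. \<Union>d\<in>\<Gamma>. {Fst a b c d, Snd a b c d})"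
  have "finite (insert Init Q)" unfolding Q_def using fin\<Gamma> by auto
  then obtain e :: "'g split_symbol \<Rightarrow> nat" where inj: "inj_on e (insert Init Q)"
    using finite_imp_inj_to_nat_seg by blast
  have Init: "Init \<notin> Q" by (auto simp: Q_def)
  have Q: "set l \<subseteq> Q" "set r \<subseteq> Q" if "split_rule P l r" for l r
    using split_rule_symbols[OF that uob] by (auto simp: Q_def)
  define enc :: "'g split_symbol list \<Rightarrow> 't sym list" where "enc = map (\<lambda>q. Nt (e q))"
  define T where "T = {a. \<exists>c\<in>\<Gamma>. fin c = Some a}"
  \<comment> \<open>The fresh axiom \<open>Init\<close> occurs on no right-hand side, which makes
    its erasing rule admissible. Letters become terminals one by one and at any moment.\<close>
  define PC where "PC = {([Nt (e Init)], enc [Plain s])} \<union> {p. b \<and> p = ([Nt (e Init)], [])}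
    \<union> (\<lambda>(l, r). (enc l, enc r)) ` {(l, r). split_rule P l r}
    \<union> (\<lambda>c. ([Nt (e (Plain c))], [Tm (the (fin c))])) ` {c \<in> \<Gamma>. fin c \<noteq> None}"
  have "T = (\<lambda>c. the (fin c)) ` {c \<in> \<Gamma>. fin c \<noteq> None}" by (force simp: T_def image_iff)
  then have finT: "finite T" using fin\<Gamma> by simp
  have enc_syms: "set (enc m) \<subseteq> syms (e ` insert Init Q) T" if "set m \<subseteq> Q" for m
    using that by (auto simp: enc_def syms_def)
  have sQ: "Plain c \<in> Q" if "c \<in> \<Gamma>" for c using that by (auto simp: Q_def)
  have notInit: "Nt (e Init) \<notin> set (enc m)" if "set m \<subseteq> Q" for m
    using that inj Init by (auto simp: enc_def inj_on_def)
  have noInit: "Nt (e Init) \<notin> set r" if "(l, r) \<in> PC" for l r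
    using that notInit[of "[Plain s]"] notInit[OF Q(2)] sQ[OF s] by (auto simp: PC_def)
  have PC_cases: "(l = [Nt (e Init)] \<and> (r = enc [Plain s] \<or> (b \<and> r = []))) \<or>
      (\<exists>l' r'. split_rule P l' r' \<and> l = enc l' \<and> r = enc r') \<or>
      (\<exists>c a. c \<in> \<Gamma> \<and> fin c = Some a \<and> l = enc [Plain c] \<and> r = [Tm a])"
    if "(l, r) \<in> PC" for l r
    using that unfolding PC_def by (auto simp: enc_def)
  have cs: "cs_grammar (e ` insert Init Q) T PC (e Init)"
    unfolding cs_grammar_def
  proof (intro conjI ballI)
    show "finite (e ` insert Init Q)" using \<open>finite (insert Init Q)\<close> by simp
    show "finite PC" unfolding PC_def using finite_split_rules[OF finP] fin\<Gamma> by simp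
  next
    fix p assume p: "p \<in> PC"
    obtain l r where lr: "p = (l, r)" by (cases p)
    have "set [Tm a] \<subseteq> syms (e ` insert Init Q) T" if "c \<in> \<Gamma>" "fin c = Some a" for a c
      using that by (auto simp: syms_def T_def)
    moreover have "set [Nt (e Init)] \<subseteq> syms (e ` insert Init Q) T" "set [] \<subseteq> syms (e ` insert Init Q) T"
      by (auto simp: syms_def)
    moreover have "set (enc [Plain c]) \<subseteq> syms (e ` insert Init Q) T" if "c \<in> \<Gamma>" for c
      using enc_syms[of "[Plain c]"] sQ[OF that] by simp
    ultimately have "set l \<subseteq> syms (e ` insert Init Q) T \<and> set r \<subseteq> syms (e ` insert Init Q) T"
      using PC_cases[of l r] p lr s enc_syms[OF Q(1)] enc_syms[OF Q(2)] by metis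
    then show "case p of (l, r) \<Rightarrow> set l \<subseteq> syms (e ` insert Init Q) T \<and> set r \<subseteq> syms (e ` insert Init Q) T"
      unfolding lr by simp
    have "(\<exists>u1 A u2 x. l = u1 @ [Nt A] @ u2 \<and> r = u1 @ x @ u2 \<and> x \<noteq> []) \<or> (l = [Nt (e Init)] \<and> r = [])"
    proof -
      have "\<exists>u1 A u2 x. enc l' = u1 @ [Nt A] @ u2 \<and> enc r' = u1 @ x @ u2 \<and> x \<noteq> []"
        if sp: "split_rule P l' r'" for l' r'
      proof -
        obtain u A v x where "l' = u @ [A] @ v" "r' = u @ x @ v" "x \<noteq> []"
          using split_rule_context_sensitive[OF sp] by blast
        then have "enc l' = enc u @ [Nt (e A)] @ enc v" "enc r' = enc u @ enc x @ enc v" "enc x \<noteq> []"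
          by (auto simp: enc_def)
        then show ?thesis by blast
      qed
      moreover have "\<exists>u1 A u2 x. [Nt n] = u1 @ [Nt A] @ u2 \<and> r' = u1 @ x @ u2 \<and> x \<noteq> []"
        if "r' \<noteq> []" for n and r' :: "'t sym list"
        using that by (intro exI[of _ "[]"] exI[of _ n] exI[of _ r']) auto
      ultimately show ?thesis using p lr unfolding PC_def by (auto simp: enc_def)
    qed
    then show "case p of (l, r) \<Rightarrow>
          (\<exists>u1 A u2 x. l = u1 @ [Nt A] @ u2 \<and> r = u1 @ x @ u2 \<and> x \<noteq> [])
        \<or> (l = [Nt (e Init)] \<and> r = [] \<and> (\<forall>(l', r') \<in> PC. Nt (e Init) \<notin> set r'))"
      unfolding lr using noInit by auto
  qed (use finT in auto)
  \<comment> \<open>A terminal is matched with any plain letter that has it as image: a letter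
    converted early takes part in no further rule and can be read as not yet converted.\<close>
  define rel where "rel x m \<longleftrightarrow> (m \<in> Q \<and> x = Nt (e m)) \<or> (\<exists>a c. x = Tm a \<and> m = Plain c \<and> fin c = Some a)"
    for x m
  have rel_enc: "list_all2 rel (enc l) m \<longleftrightarrow> m = l" if "set l \<subseteq> Q" for l m
    using that
  proof (induction l arbitrary: m)
    case (Cons q l)
    have "rel (Nt (e q)) q' \<longleftrightarrow> q' = q" for q'
      using Cons.prems inj by (auto simp: rel_def inj_on_def)
    then show ?case using Cons by (auto simp: enc_def list_all2_Cons1)
  qed (auto simp: enc_def)
  have rel_Tm: "rel (Tm a) m \<longleftrightarrow> (\<exists>c. m = Plain c \<and> fin c = Some a)" for a m
    by (auto simp: rel_def)
  have sound: "(y = [] \<and> b) \<or> y = [Nt (e Init)] \<or> (\<exists>m. list_all2 rel y m \<and> (rewrite P)\<^sup>*\<^sup>* [s] (contract m))"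
    if "(rewrite PC)\<^sup>*\<^sup>* [Nt (e Init)] y" for y
    using that
  proof (induction rule: rtranclp_induct)
    case (step y y')
    from step.hyps(2) obtain x x' l r where lr: "(l, r) \<in> PC" "y = x @ l @ x'" "y' = x @ r @ x'"
      by (auto simp: rewrite_def)
    have ne: "l \<noteq> []" using lr(1) cs by (auto simp: cs_grammar_def)
    have rel_PlainS: "list_all2 rel (enc [Plain s]) [Plain s]" using rel_enc[of "[Plain s]"] sQ s by auto
    show ?case
    proof (cases "y = [Nt (e Init)]")
      case True
      then have "x = []" "x' = []" "l = [Nt (e Init)]" using lr(2) ne
        by (auto simp: append_eq_Cons_conv)
      moreover have "enc l' \<noteq> [Nt (e Init)]" if "split_rule P l' r'" for l' r'
        using notInit[OF Q(1)[OF that(1)]] by auto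
      moreover have "enc [Plain c] \<noteq> [Nt (e Init)]" if "c \<in> \<Gamma>" for c
        using notInit[of "[Plain c]"] sQ[OF that] by auto
      ultimately have "r = enc [Plain s] \<or> (b \<and> r = [])"
        using PC_cases[OF lr(1)] by metis
      then show ?thesis using lr(3) rel_PlainS \<open>x = []\<close> \<open>x' = []\<close>
        by (auto intro!: exI[of _ "[Plain s]"])
    next
      case False
      then obtain m where m: "list_all2 rel y m" "(rewrite P)\<^sup>*\<^sup>* [s] (contract m)"
        using step.IH lr(2) ne by auto
      then obtain m1 m2 m3 where m123: "m = m1 @ m2 @ m3" "list_all2 rel x m1" "list_all2 rel l m2"
        "list_all2 rel x' m3" unfolding lr(2) by (auto simp: list_all2_append1)
      consider "l = [Nt (e Init)]"
        | l' r' where "split_rule P l' r'" "l = enc l'" "r = enc r'"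
        | c a where "c \<in> \<Gamma>" "fin c = Some a" "l = enc [Plain c]" "r = [Tm a]"
        using PC_cases[OF lr(1)] by blast
      then show ?thesis
      proof cases
        case 1
        then show ?thesis using m123(3) inj Init
          by (auto simp: list_all2_Cons1 rel_def inj_on_def)
      next
        case 2
        have m2: "m2 = l'" using m123(3) rel_enc[OF Q(1)[OF 2(1)]] 2(2) by simp
        have "list_all2 rel r r'" using rel_enc[OF Q(2)[OF 2(1)]] 2(3) by simp
        then have "list_all2 rel y' (m1 @ r' @ m3)" unfolding lr(3) using m123 by (intro list_all2_appendI)
        moreover have "(rewrite P)\<^sup>*\<^sup>* [s] (contract (m1 @ r' @ m3))"
          using m(2) split_rule_sound[OF 2(1), of m1 m3] unfolding m123(1) m2 by (rule rtranclp_trans)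
        ultimately show ?thesis by blast
      next
        case 3
        then have "m2 = [Plain c]" using m123(3) rel_enc[of "[Plain c]"] sQ by auto
        moreover have "list_all2 rel [Tm a] [Plain c]" using 3 by (auto simp: rel_def)
        ultimately have "list_all2 rel y' (m1 @ m2 @ m3)"
          unfolding lr(3) using m123 3(4) by (intro list_all2_appendI) auto
        then show ?thesis using m(2) m123(1) by blast
      qed
    qed
  qed auto
  have "cs_lang PC (e Init) = ?L"
  proof (intro set_eqI iffI)
    fix z assume "z \<in> cs_lang PC (e Init)"
    then have "(rewrite PC)\<^sup>*\<^sup>* [Nt (e Init)] (map Tm z)" by (simp add: cs_lang_def step_eq_rewrite)
    from sound[OF this] show "z \<in> ?L"
    proof (elim disjE exE conjE)
      fix m assume m: "list_all2 rel (map Tm z) m" "(rewrite P)\<^sup>*\<^sup>* [s] (contract m)"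
      from m(1) have "\<exists>w. m = map Plain w \<and> map fin w = map Some z"
      proof (induction z arbitrary: m)
        case (Cons a z)
        then obtain c m' where c: "m = Plain c # m'" "fin c = Some a" "list_all2 rel (map Tm z) m'"
          by (auto simp: list_all2_Cons1 rel_Tm)
        obtain w where "m' = map Plain w \<and> map fin w = map Some z" using Cons.IH[OF c(3)] by blast
        then show ?case using c by (intro exI[of _ "c # w"]) auto
      qed auto
      then obtain w where w: "m = map Plain w" "map fin w = map Some z" by blast
      then have "contract m = w" using contract_Plain[of w "[]"] by simp
      then show ?thesis using m(2) w by auto
    qed auto
  next
    fix z assume "z \<in> ?L"
    then consider w where "(rewrite P)\<^sup>*\<^sup>* [s] w" "map fin w = map Some z" | "z = []" b by auto
    then have "(rewrite PC)\<^sup>*\<^sup>* [Nt (e Init)] (map Tm z)"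
    proof cases
      case 1
      have rule: "(rewrite PC)\<^sup>*\<^sup>* l r" if "(l, r) \<in> PC" for l r
        using rewriteI[OF that, of "[]" "[]"] by auto
      have lift: "(rewrite PC)\<^sup>*\<^sup>* (enc u) (enc v)" if "(rewrite {(l, r). split_rule P l r})\<^sup>*\<^sup>* u v" for u v
        using that
      proof (induction rule: rtranclp_induct)
        case (step v v')
        obtain x y l r where "split_rule P l r" "v = x @ l @ y" "v' = x @ r @ y"
          using step.hyps(2) by (auto simp: rewrite_def)
        moreover from this have "(enc l, enc r) \<in> PC" by (auto simp: PC_def)
        ultimately have "rewrite PC (enc v) (enc v')"
          using rewriteI[of "enc l" "enc r" PC "enc x" "enc y"] by (simp add: enc_def)
        then show ?case using step.IH by auto
      qed auto
      have "(rewrite {(l, r). split_rule P l r})\<^sup>*\<^sup>* (map Plain [s]) (map Plain w) \<and> set w \<subseteq> \<Gamma>"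
        using 1(1)
      proof (induction rule: rtranclp_induct)
        case (step v v')
        obtain x y l r where "(l, r) \<in> P" "v = x @ l @ y" "v' = x @ r @ y"
          using step.hyps(2) by (auto simp: rewrite_def)
        moreover from this uob have "set r \<subseteq> \<Gamma>" by (auto simp: unary_or_binary_def)
        ultimately have "set v' \<subseteq> \<Gamma>" using step.IH by simp
        then show ?case using step.IH split_rule_complete[OF step.hyps(2) uob] by (meson rtranclp_trans)
      qed (use s in auto)
      then have w: "(rewrite PC)\<^sup>*\<^sup>* (enc [Plain s]) (enc (map Plain w))" "set w \<subseteq> \<Gamma>"
        using lift[of "map Plain [s]" "map Plain w"] by auto
      have "(rewrite PC)\<^sup>*\<^sup>* (enc (map Plain w)) (map Tm z)"
        using 1(2) w(2)
      proof (induction w arbitrary: z)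
        case (Cons c w)
        then obtain a z' where z: "z = a # z'" "fin c = Some a" "map fin w = map Some z'"
          by (auto simp: Cons_eq_map_conv)
        then have "([Nt (e (Plain c))], [Tm a]) \<in> PC"
          using Cons.prems(2) by (force simp: PC_def image_iff)
        from rewrites_append[OF rule[OF this] Cons.IH[OF z(3)]] Cons.prems(2) z(1)
        show ?case by (simp add: enc_def)
      qed (auto simp: enc_def)
      moreover have "(rewrite PC)\<^sup>*\<^sup>* [Nt (e Init)] (enc [Plain s])" by (rule rule) (simp add: PC_def)
      ultimately show ?thesis using w(1) by (meson rtranclp_trans)
    next
      case 2
      then have "rewrite PC [Nt (e Init)] []"
        using rewriteI[of "[Nt (e Init)]" "[]" PC "[]" "[]"] by (simp add: PC_def)
      then show ?thesis using 2 by auto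
    qed
    then show "z \<in> cs_lang PC (e Init)" unfolding cs_lang_def step_eq_rewrite by (rule CollectI)
  qed
  note lang = this
  have "\<exists>N T P S. cs_grammar N T P S \<and> cs_lang PC (e Init) = cs_lang P S"
    by (rule exI, rule exI, rule exI, rule exI, rule conjI, rule cs, rule refl)
  then have "cs_lang PC (e Init) \<in> CS" by (simp only: CS_def mem_Collect_eq)
  then show ?thesis by (simp only: lang)
qed

section \<open>From context-sensitive to tree-controlled grammars\<close>

fun flag :: "bool \<Rightarrow> bool \<Rightarrow> 'a list \<Rightarrow> ('a \<times> bool \<times> bool) list" where
  "flag f l [] = []"
| "flag f l (x # xs) = (x, f, l \<and> xs = []) # flag False l xs"

text \<open>The arguments \<open>f\<close> and \<open>l\<close> tell whether a list stands at the
  left and the right end of the whole word, so a piece replaced inside a word can be flagged by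
  itself.\<close>

lemma flag_append: "flag f l (xs @ ys) = flag f (l \<and> ys = []) xs @ flag (f \<and> xs = []) l ys"
  by (induction xs arbitrary: f) auto

lemma map_fst_flag [simp]: "map fst (flag f l xs) = xs"
  by (induction xs arbitrary: f) auto

lemma flag_eq_Nil [simp]: "flag f l xs = [] \<longleftrightarrow> xs = []"
  by (cases xs) auto

lemma in_flagD:
  "(x, f', l') \<in> set (flag f l xs) \<Longrightarrow> x \<in> set xs \<and> (f' \<longrightarrow> f \<and> x = hd xs) \<and> (l' \<longrightarrow> x = last xs)"
  by (induction xs arbitrary: f) auto

lemma hd_flag: "xs \<noteq> [] \<Longrightarrow> \<exists>l'. hd (flag f l xs) = (hd xs, f, l')"
  by (cases xs) auto

lemma last_flag: "xs \<noteq> [] \<Longrightarrow> \<exists>f'. last (flag f l xs) = (last xs, f', l)"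
  by (induction xs arbitrary: f) auto

section \<open>Marked occurrences of left-hand sides\<close>

datatype 't base = Symbol "'t sym" | Mark "'t sym list" "'t sym list" nat

text \<open>A mark still stands for the letter it replaced; its rule counts as applied only when the
  marks are turned into \<open>r\<close>.\<close>

fun base_sym :: "'t base \<Rightarrow> 't sym" where
  "base_sym (Symbol c) = c"
| "base_sym (Mark l r i) = l ! i"

fun block_start :: "'t base \<Rightarrow> bool" where
  "block_start (Symbol c) \<longleftrightarrow> True"
| "block_start (Mark l r i) \<longleftrightarrow> i = 0"

fun block_end :: "'t base \<Rightarrow> bool" where
  "block_end (Symbol c) \<longleftrightarrow> True"
| "block_end (Mark l r i) \<longleftrightarrow> Suc i = length l"

text \<open>Along a word that begins with a block start and ends with a block end, this forces the
  marks into complete blocks with indices \<open>0\<close> to \<open>length l - 1\<close> of one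
  rule.\<close>

fun follows :: "'t base \<Rightarrow> 't base \<Rightarrow> bool" where
  "follows (Symbol c) b \<longleftrightarrow> block_start b"
| "follows (Mark l r i) b \<longleftrightarrow> (if Suc i < length l then b = Mark l r (Suc i) else block_start b)"

text \<open>Each mark but the last yields one letter of \<open>r\<close>, the last yields the rest.
  If \<open>length l \<le> length r\<close>, every mark yields something.\<close>

inductive base_rule :: "('t sym list \<times> 't sym list) set \<Rightarrow> 't base \<Rightarrow> 't base list \<Rightarrow> bool" for P where
  keep: "base_rule P (Symbol c) [Symbol c]"
| mark: "(l, r) \<in> P \<Longrightarrow> i < length l \<Longrightarrow> base_rule P (Symbol (l ! i)) [Mark l r i]"
| emit: "(l, r) \<in> P \<Longrightarrow> Suc i < length l \<Longrightarrow> base_rule P (Mark l r i) [Symbol (r ! i)]"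
| emit_last: "(l, r) \<in> P \<Longrightarrow> Suc i = length l \<Longrightarrow> base_rule P (Mark l r i) (map Symbol (drop i r))"

text \<open>The effect of a step on the represented word; whether a symbol is kept or marked makes
  no difference there.\<close>

inductive emits :: "('t sym list \<times> 't sym list) set \<Rightarrow> 't base \<Rightarrow> 't sym list \<Rightarrow> bool" for P where
  "emits P (Symbol c) [c]"
| "(l, r) \<in> P \<Longrightarrow> Suc i < length l \<Longrightarrow> emits P (Mark l r i) [r ! i]"
| "(l, r) \<in> P \<Longrightarrow> Suc i = length l \<Longrightarrow> emits P (Mark l r i) (drop i r)"

lemma base_rule_emits: "base_rule P b g \<Longrightarrow> emits P b (map base_sym g)"
proof (induction rule: base_rule.induct)
  case (emit_last l r i)
  then show ?case using emits.intros(3)[OF emit_last] by (simp add: o_def)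
qed (auto intro: emits.intros)

text \<open>The induction runs over suffixes of a word, which may begin inside a block of marks.\<close>

lemma emits_sound:
  assumes "list_all2 (emits P) bs gs" and "successively follows bs"
    and "bs \<noteq> [] \<longrightarrow> block_end (last bs)" and "\<And>l r. (l, r) \<in> P \<Longrightarrow> length l \<le> length r"
  shows "(\<forall>l r i bs'. bs = Mark l r i # bs' \<longrightarrow> (\<exists>u v. map base_sym bs = drop i l @ u
            \<and> concat gs = drop i r @ v \<and> (rewrite P)\<^sup>*\<^sup>* u v))
    \<and> (bs = [] \<or> block_start (hd bs) \<longrightarrow> (rewrite P)\<^sup>*\<^sup>* (map base_sym bs) (concat gs))"
  using assms(1-3)
proof (induction bs gs rule: list_all2_induct)
  case Nil
  then show ?case by simp
next
  case (Cons b bs g gs)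
  have prems: "successively follows bs" "bs \<noteq> [] \<longrightarrow> block_end (last bs)"
    using Cons.prems by (cases bs; auto)+
  have IH: "bs = Mark l r i # bs' \<Longrightarrow> \<exists>u v. map base_sym bs = drop i l @ u
            \<and> concat gs = drop i r @ v \<and> (rewrite P)\<^sup>*\<^sup>* u v"
       "bs = [] \<or> block_start (hd bs) \<Longrightarrow> (rewrite P)\<^sup>*\<^sup>* (map base_sym bs) (concat gs)"
    for l r i bs'
    using Cons.IH[OF prems] by blast+
  have nxt: "bs = [] \<or> follows b (hd bs)" using Cons.prems(1) by (auto simp: successively_Cons)
  show ?case
    using Cons.hyps(1)
  proof cases
    case (1 c)
    then have "bs = [] \<or> block_start (hd bs)" using nxt by auto
    from rewrites_append[OF rtranclp.rtrancl_refl IH(2)[OF this], of "[c]"] 1 show ?thesis by simp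
  next
    case (2 l r i)
    \<comment> \<open>A mark that is not the last of its block cannot end the word, so its successor
      is forced and the part of the hypothesis about open blocks applies.\<close>
    then have "bs \<noteq> []" using Cons.prems(2) by auto
    then have "bs = Mark l r (Suc i) # tl bs" using nxt 2 by (cases bs) auto
    from IH(1)[OF this] obtain u v where uv: "map base_sym bs = drop (Suc i) l @ u"
      "concat gs = drop (Suc i) r @ v" "(rewrite P)\<^sup>*\<^sup>* u v" by blast
    have "i < length r" using 2 assms(4)[of l r] by simp
    then have *: "map base_sym (b # bs) = drop i l @ u" "concat (g # gs) = drop i r @ v"
      using uv 2 by (simp_all add: Cons_nth_drop_Suc[symmetric])
    \<comment> \<open>At index 0 the whole of \<open>l\<close> is present: one step replaces it by
      \<open>r\<close>, and the steps for the remaining word follow behind it.\<close>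
    have "(rewrite P)\<^sup>*\<^sup>* (map base_sym (b # bs)) (concat (g # gs))" if "i = 0"
    proof -
      have "rewrite P (l @ u) (r @ u)" using rewriteI[OF 2(3), of "[]" u] by simp
      moreover have "(rewrite P)\<^sup>*\<^sup>* (r @ u) (r @ v)" using rewrites_context[OF uv(3), of r "[]"] by simp
      ultimately show ?thesis unfolding * using that by simp
    qed
    then show ?thesis using * uv(3) 2 by auto
  next
    case (3 l r i)
    then have "bs = [] \<or> block_start (hd bs)" using nxt by auto
    note tail = IH(2)[OF this]
    have "drop i l = [l ! i]" using 3 by (simp add: Cons_nth_drop_Suc[symmetric])
    then have *: "map base_sym (b # bs) = drop i l @ map base_sym bs" "concat (g # gs) = drop i r @ concat gs"
      using 3 by simp_all
    have "(rewrite P)\<^sup>*\<^sup>* (map base_sym (b # bs)) (concat (g # gs))" if "i = 0"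
    proof -
      have "rewrite P (l @ map base_sym bs) (r @ map base_sym bs)"
        using rewriteI[OF 3(3), of "[]" "map base_sym bs"] by simp
      moreover have "(rewrite P)\<^sup>*\<^sup>* (r @ map base_sym bs) (r @ concat gs)"
        using rewrites_context[OF tail, of r "[]"] by simp
      ultimately show ?thesis unfolding * using that by simp
    qed
    moreover have "\<exists>u v. map base_sym (b # bs) = drop i l @ u \<and> concat (g # gs) = drop i r @ v
        \<and> (rewrite P)\<^sup>*\<^sup>* u v" using * tail by blast
    ultimately show ?thesis using 3(1) by (auto simp del: list.map concat.simps)
  qed
qed

definition bases :: "'t sym set \<Rightarrow> ('t sym list \<times> 't sym list) set \<Rightarrow> 't base set" where
  "bases \<Sigma> P = Symbol ` \<Sigma> \<union> (\<Union>(l, r)\<in>P. Mark l r ` {..<length l})"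

lemma finite_bases: "finite \<Sigma> \<Longrightarrow> finite P \<Longrightarrow> finite (bases \<Sigma> P)"
  by (auto simp: bases_def)

section \<open>The tree-controlled grammar built from marks\<close>

locale marking =
  fixes N :: "nat set" and T :: "'t set" and P :: "('t sym list \<times> 't sym list) set" and S :: nat
    and e :: "('t base \<times> bool \<times> bool) option \<Rightarrow> nat" and erase :: bool
  assumes finite_syms: "finite (syms N T)" and finite_T: "finite T" and S: "S \<in> N" and finite_P: "finite P"
    and rules: "\<And>l r. (l, r) \<in> P \<Longrightarrow>
      l \<noteq> [] \<and> length l \<le> length r \<and> set l \<subseteq> syms N T \<and> set r \<subseteq> syms N T"
    and inj: "inj_on e (insert None (Some ` (bases (syms N T) P \<times> UNIV)))"
begin

definition "cells = bases (syms N T) P \<times> (UNIV :: (bool \<times> bool) set)"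

definition cell :: "'t base \<times> bool \<times> bool \<Rightarrow> 't sym" where "cell x = Nt (e (Some x))"

definition "start = e None"

text \<open>The start symbol is in no admissible pair, so it occurs only as a word of length one. A
  flag restricts the letter that carries it; that the end letters do carry their flags is left to
  the productions.\<close>

definition "control = pair_lang
  (insert (Nt start) (cell ` {(b, f, l) \<in> cells. (f \<longrightarrow> block_start b) \<and> (l \<longrightarrow> block_end b)}))
  (\<lambda>x y. \<exists>u\<in>cells. \<exists>v\<in>cells. x = cell u \<and> y = cell v \<and> follows (fst u) (fst v))"

text \<open>A replacement inherits the flags of the place it fills, so the flags stay true. The
  erasing rule is left out, to be added back by \<open>tc_lang_erasing\<close>.\<close>

definition "core = {(start, [cell (Symbol (Nt S), True, True)])}
  \<union> {(e (Some (b, f, l)), map cell (flag f l g)) | b f l g. b \<in> bases (syms N T) P \<and> base_rule P b g}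
  \<union> {(e (Some (Symbol (Tm a), f, l)), [Tm a]) | a f l. a \<in> T}"

definition "productions = core \<union> {p. erase \<and> p = (start, [])}"

lemma cell_inj: "x \<in> cells \<Longrightarrow> y \<in> cells \<Longrightarrow> cell x = cell y \<longleftrightarrow> x = y"
  using inj_on_eq_iff[OF inj, of "Some x" "Some y"] unfolding cell_def cells_def by blast

lemma cell_start: "x \<in> cells \<Longrightarrow> cell x \<noteq> Nt start"
  using inj by (auto simp: cell_def start_def cells_def inj_on_def)

lemma base_rule_bases: "base_rule P b g \<Longrightarrow> b \<in> bases (syms N T) P \<Longrightarrow> set g \<subseteq> bases (syms N T) P \<and> g \<noteq> []"
proof (induction rule: base_rule.induct)
  case (mark l r i)
  then show ?case by (auto simp: bases_def)
next
  case (emit l r i)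
  then have "r ! i \<in> syms N T" using rules[OF emit(1)] by (meson Suc_lessD less_le_trans nth_mem subsetD)
  then show ?case by (auto simp: bases_def)
next
  case (emit_last l r i)
  then have "set (drop i r) \<subseteq> syms N T" using rules[OF emit_last(1)] set_drop_subset by fast
  then show ?case using rules[OF emit_last(1)] emit_last(2) by (auto simp: bases_def)
qed simp

lemma flag_cells: "set g \<subseteq> bases (syms N T) P \<Longrightarrow> set (flag f l g) \<subseteq> cells"
  by (auto simp: cells_def dest: in_flagD)

lemma SymbolS: "Symbol (Nt S) \<in> bases (syms N T) P"
  using S by (auto simp: bases_def syms_def)

lemma core_nonempty: "(A, w) \<in> core \<Longrightarrow> w \<noteq> []"
  using base_rule_bases by (auto simp: core_def)

lemma core_cases:
  assumes "(A, w) \<in> core"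
  obtains (initial) "A = start" "w = [cell (Symbol (Nt S), True, True)]"
  | (base) b f l g where "A = e (Some (b, f, l))" "w = map cell (flag f l g)"
      "b \<in> bases (syms N T) P" "base_rule P b g"
  | (final) a f l where "A = e (Some (Symbol (Tm a), f, l))" "w = [Tm a]" "a \<in> T"
  using assms unfolding core_def by auto

lemma core_symbols:
  assumes "(A, w) \<in> core"
  shows "A \<in> e ` insert None (Some ` cells) \<and> set w \<subseteq> cell ` cells \<union> Tm ` T"
  using assms
proof (cases rule: core_cases)
  case initial
  then show ?thesis using SymbolS by (simp add: start_def cells_def)
next
  case (base b f l g)
  have "(b, f, l) \<in> cells" using base(3) by (simp add: cells_def)
  then have "A \<in> e ` insert None (Some ` cells)" unfolding base(1) by (intro imageI) simp
  moreover have "set w \<subseteq> cell ` cells"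
    unfolding base(2) set_map using flag_cells base_rule_bases[OF base(4,3)] by (intro image_mono) simp
  ultimately show ?thesis by blast
next
  case (final a f l)
  then have "(Symbol (Tm a), f, l) \<in> cells" by (auto simp: cells_def bases_def syms_def)
  then have "A \<in> e ` insert None (Some ` cells)" unfolding final(1) by (intro imageI) simp
  then show ?thesis using final by simp
qed

lemma finite_cells: "finite cells"
  unfolding cells_def using finite_bases[OF finite_syms finite_P] by simp

lemma finite_core: "finite core"
proof -
  \<comment> \<open>The positions in left-hand sides index all rules that create or consume a
    mark.\<close>
  define K where "K = (\<Union>(l, r)\<in>P. {(l, r)} \<times> {..<length l})"
  have "finite K" using finite_P by (auto simp: K_def)
  have "{(b, g). b \<in> bases (syms N T) P \<and> base_rule P b g} \<subseteq>
    (\<lambda>c. (Symbol c, [Symbol c])) ` syms N T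
    \<union> (\<lambda>((l, r), i). (Symbol (l ! i), [Mark l r i])) ` K
    \<union> (\<lambda>((l, r), i). (Mark l r i, [Symbol (r ! i)])) ` K
    \<union> (\<lambda>((l, r), i). (Mark l r i, map Symbol (drop i r))) ` K" (is "?B \<subseteq> ?C")
  proof (intro subsetI)
    fix p assume "p \<in> ?B"
    then obtain b g where p: "p = (b, g)" "b \<in> bases (syms N T) P" and "base_rule P b g" by auto
    have K: "((l, r), i) \<in> K" if "(l, r) \<in> P" "i < length l" for l r i
      using that by (auto simp: K_def)
    from \<open>base_rule P b g\<close> show "p \<in> ?C"
    proof cases
      case (keep c)
      then show ?thesis using p by (auto simp: bases_def)
    next
      case (mark l r i)
      then have "p = (\<lambda>((l, r), i). (Symbol (l ! i), [Mark l r i])) ((l, r), i)" using p by simp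
      then show ?thesis using K[OF mark(3,4)] by blast
    next
      case (emit l r i)
      then have "p = (\<lambda>((l, r), i). (Mark l r i, [Symbol (r ! i)])) ((l, r), i)" using p by simp
      moreover have "((l, r), i) \<in> K" using K[OF emit(3)] emit(4) by simp
      ultimately show ?thesis by blast
    next
      case (emit_last l r i)
      then have "p = (\<lambda>((l, r), i). (Mark l r i, map Symbol (drop i r))) ((l, r), i)" using p by simp
      moreover have "((l, r), i) \<in> K" using K[OF emit_last(3)] emit_last(4) by simp
      ultimately show ?thesis by blast
    qed
  qed
  moreover have "finite ?C" using finite_syms \<open>finite K\<close> by simp
  ultimately have fin: "finite ?B" by (rule finite_subset)
  have "core \<subseteq> {(start, [cell (Symbol (Nt S), True, True)])}
    \<union> (\<lambda>((b, g), f, l). (e (Some (b, f, l)), map cell (flag f l g))) ` (?B \<times> UNIV)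
    \<union> (\<lambda>(a, f, l). (e (Some (Symbol (Tm a), f, l)), [Tm a])) ` (T \<times> UNIV)"
    (is "core \<subseteq> ?D")
  proof (intro subsetI)
    fix p assume "p \<in> core"
    then obtain A w where p: "p = (A, w)" "(A, w) \<in> core" by (cases p) auto
    from p(2) show "p \<in> ?D"
    proof (cases rule: core_cases)
      case (base b f l g)
      then have "p = (\<lambda>((b, g), f, l). (e (Some (b, f, l)), map cell (flag f l g))) ((b, g), f, l)"
        "((b, g), f, l) \<in> ?B \<times> UNIV" using p(1) by auto
      then show ?thesis by blast
    next
      case (final a f l)
      then have "p = (\<lambda>(a, f, l). (e (Some (Symbol (Tm a), f, l)), [Tm a])) (a, f, l)"
        "(a, f, l) \<in> T \<times> UNIV" using p(1) by auto
      then show ?thesis by blast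
    qed (simp add: p)
  qed
  moreover have "finite ?D" using fin finite_T by simp
  ultimately show ?thesis by (rule finite_subset)
qed

lemma productions_grammar: "tc_grammar (e ` insert None (Some ` cells)) T productions start control"
proof -
  have cells: "cell ` cells \<union> {Nt start} \<union> Tm ` T = syms (e ` insert None (Some ` cells)) T"
    by (auto simp: syms_def cell_def start_def image_iff)
  have *: "Nt start \<notin> set w" if "(A, w) \<in> productions" for A w
  proof
    assume "Nt start \<in> set w"
    then have "(A, w) \<in> core" using that by (auto simp: productions_def)
    then have "Nt start \<in> cell ` cells \<union> Tm ` T" using core_symbols \<open>Nt start \<in> set w\<close> by blast
    then obtain x where "x \<in> cells" "cell x = Nt start" by fastforce
    then show False using cell_start by blast
  qed
  moreover have "finite productions"
    using finite_core by (auto simp: productions_def intro: finite_subset[of _ "{(start, [])}"])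
  ultimately have "cf_grammar (e ` insert None (Some ` cells)) T productions start"
    unfolding cf_grammar_def cells[symmetric]
  proof (intro conjI ballI)
    fix p assume p: "p \<in> productions"
    obtain A w where Aw: "p = (A, w)" by (cases p)
    have "A \<in> e ` insert None (Some ` cells) \<and> set w \<subseteq> cell ` cells \<union> Tm ` T \<and> (w = [] \<longrightarrow> A = start)"
      using p Aw core_symbols[of A w] core_nonempty[of A w] by (auto simp: productions_def start_def)
    then show "case p of (A, w) \<Rightarrow> A \<in> e ` insert None (Some ` cells)
        \<and> set w \<subseteq> cell ` cells \<union> {Nt start} \<union> Tm ` T"
      "case p of (A, w) \<Rightarrow> w = [] \<longrightarrow> A = start \<and> (\<forall>(B, u)\<in>productions. Nt start \<notin> set u)"
      unfolding Aw using * by auto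
  qed (use finite_cells finite_T in \<open>auto simp: start_def\<close>)
  moreover have "control \<subseteq> lists (syms (e ` insert None (Some ` cells)) T)"
    unfolding control_def pair_lang_def cells[symmetric] by fastforce
  ultimately show ?thesis by (simp add: tc_grammar_def)
qed

lemma nonerasing_productions: "nonerasing productions = core"
  using core_nonempty by (auto simp: nonerasing_def productions_def)

section \<open>Simulation of context-sensitive derivations\<close>

definition enc :: "bool \<Rightarrow> bool \<Rightarrow> 't base list \<Rightarrow> ('t sym \<times> bool) list" where
  "enc f l bs = map (\<lambda>x. (cell x, True)) (flag f l bs)"

lemma enc_control:
  assumes "set bs \<subseteq> bases (syms N T) P" and "successively follows bs"
    and "bs \<noteq> [] \<longrightarrow> block_start (hd bs) \<and> block_end (last bs)"
  shows "active (enc True True bs) \<in> control"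
proof -
  have act: "active (enc True True bs) = map cell (flag True True bs)"
    by (simp add: enc_def active_def o_def filter_map)
  have "successively (\<lambda>x y. follows (fst x) (fst y)) (flag True True bs)"
    using assms(2) successively_map[of follows fst "flag True True bs"] by simp
  then have adj: "successively (\<lambda>x y. \<exists>u\<in>cells. \<exists>v\<in>cells. cell x = cell u \<and> cell y = cell v \<and> follows (fst u) (fst v))
    (flag True True bs)"
  proof (rule successively_mono)
    fix x y assume xy: "x \<in> set (flag True True bs)" "y \<in> set (flag True True bs)" "follows (fst x) (fst y)"
    then have "x \<in> cells" "y \<in> cells" using flag_cells[OF assms(1)] by blast+
    then show "\<exists>u\<in>cells. \<exists>v\<in>cells. cell x = cell u \<and> cell y = cell v \<and> follows (fst u) (fst v)"
      using xy(3) by (intro bexI conjI) (rule refl | assumption)+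
  qed
  have "cell x \<in> cell ` {(b, f, l) \<in> cells. (f \<longrightarrow> block_start b) \<and> (l \<longrightarrow> block_end b)}"
    if x: "x \<in> set (flag True True bs)" for x
  proof (rule imageI)
    have "bs \<noteq> []" using x by auto
    then show "x \<in> {(b, f, l) \<in> cells. (f \<longrightarrow> block_start b) \<and> (l \<longrightarrow> block_end b)}"
      using x flag_cells[OF assms(1)] in_flagD[of "fst x" "fst (snd x)" "snd (snd x)" True True bs] assms(3)
      by (cases x) auto
  qed
  then show ?thesis unfolding act control_def pair_lang_def mem_Collect_eq successively_map
    using adj by (intro conjI) auto
qed

lemma enc_rewrite_all:
  assumes "list_all2 (base_rule P) bs gs" and "set bs \<subseteq> bases (syms N T) P"
  shows "rewrite_all core (enc f l bs) (enc f l (concat gs))"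
  using assms
proof (induction bs gs arbitrary: f rule: list_all2_induct)
  case (Cons b bs g gs)
  have gs: "concat gs = [] \<longleftrightarrow> bs = []"
    using Cons.hyps(2) Cons.prems base_rule_bases
    by (cases bs; cases gs) auto
  have g: "g \<noteq> []" using base_rule_bases Cons by auto
  have step: "letter_step core (cell (b, f, l \<and> bs = []), True) (enc f (l \<and> bs = []) g)"
    using letter_step.expand[of "e (Some (b, f, l \<and> bs = []))" "map cell (flag f (l \<and> bs = []) g)" core]
      Cons.hyps(1) Cons.prems by (auto simp: enc_def cell_def core_def o_def)
  have rest: "rewrite_all core (enc False l bs) (enc False l (concat gs))"
    using Cons by auto
  have cat: "enc f l (concat (g # gs)) = enc f (l \<and> bs = []) g @ enc False l (concat gs)"
    using g gs by (auto simp: enc_def flag_append)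
  have cons: "enc f l (b # bs) = (cell (b, f, l \<and> bs = []), True) # enc False l bs"
    by (simp add: enc_def)
  show ?case unfolding cons cat rewrite_all_Cons using step rest by blast
qed (simp add: enc_def)

lemma enc_par_step:
  assumes "list_all2 (base_rule P) bs gs" and "set bs \<subseteq> bases (syms N T) P" and "successively follows bs"
    and "bs \<noteq> [] \<longrightarrow> block_start (hd bs) \<and> block_end (last bs)"
  shows "par_step core control (enc True True bs) (enc True True (concat gs))"
  unfolding par_step_def using enc_rewrite_all enc_control assms by blast

lemma successively_Symbol: "successively follows (map Symbol w)"
  by (auto simp: successively_conv_nth)

lemma simulate_rule:
  assumes "rewrite P u v" and "set u \<subseteq> syms N T"
  shows "(par_step core control)\<^sup>*\<^sup>* (enc True True (map Symbol u)) (enc True True (map Symbol v))"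
proof -
  obtain x y l r where lr: "(l, r) \<in> P" "u = x @ l @ y" "v = x @ r @ y"
    using assms(1) by (auto simp: rewrite_def)
  note lrP = rules[OF lr(1)]
  let ?m = "map (Mark l r) [0..<length l]"
  \<comment> \<open>The level between the two parallel steps: only the chosen occurrence is marked,
    everything else is kept.\<close>
  let ?bs = "map Symbol x @ ?m @ map Symbol y"
  have keep: "list_all2 (base_rule P) (map Symbol w) (map (\<lambda>c. [Symbol c]) w)" for w
    by (induction w) (auto intro: base_rule.keep)
  have sing: "concat (map (\<lambda>c. [h c]) w) = map h w" for h :: "'a \<Rightarrow> 'b" and w
    by (induction w) auto
  have bases_u: "set (map Symbol u) \<subseteq> bases (syms N T) P" using assms(2) by (auto simp: bases_def)
  have "list_all2 (base_rule P) (map Symbol l) (map (\<lambda>i. [Mark l r i]) [0..<length l])"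
    using lr(1) by (auto simp: list_all2_conv_all_nth intro: base_rule.mark)
  then have "list_all2 (base_rule P) (map Symbol u)
      (map (\<lambda>c. [Symbol c]) x @ map (\<lambda>i. [Mark l r i]) [0..<length l] @ map (\<lambda>c. [Symbol c]) y)"
    unfolding lr(2) map_append using keep by (intro list_all2_appendI)
  from enc_par_step[OF this bases_u successively_Symbol]
  have 1: "par_step core control (enc True True (map Symbol u)) (enc True True ?bs)"
    by (auto simp: sing hd_map last_map)
  let ?g = "\<lambda>i. if Suc i < length l then [Symbol (r ! i)] else map Symbol (drop i r)"
  have "list_all2 (base_rule P) ?m (map ?g [0..<length l])"
    using lr(1) by (auto simp: list_all2_conv_all_nth intro: base_rule.intros)
  then have "list_all2 (base_rule P) ?bs
    (map (\<lambda>c. [Symbol c]) x @ map ?g [0..<length l] @ map (\<lambda>c. [Symbol c]) y)"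
    using keep by (intro list_all2_appendI)
  moreover have "set ?bs \<subseteq> bases (syms N T) P" using bases_u lr by (auto simp: bases_def)
  moreover have "successively follows ?bs"
  proof -
    have "successively follows ?m" by (auto simp: successively_conv_nth)
    moreover have "?m \<noteq> []" "hd ?m = Mark l r 0" "last ?m = Mark l r (length l - 1)"
      using lrP by (auto simp: hd_map last_map)
    moreover have "y \<noteq> [] \<Longrightarrow> follows (Mark l r (length l - 1)) (hd (map Symbol y))"
      using lrP by (cases y) auto
    moreover have "x \<noteq> [] \<Longrightarrow> follows (last (map Symbol x)) (Mark l r 0)"
      by (cases x rule: rev_cases) auto
    ultimately show ?thesis
      unfolding successively_append_iff using successively_Symbol by (auto simp del: hd_map)
  qed
  moreover have "block_start (hd ?bs) \<and> block_end (last ?bs)"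
    using lrP by (auto simp: hd_append last_append hd_map last_map)
  moreover have "concat (map ?g [0..<length l]) = map Symbol r"
  proof -
    \<comment> \<open>The marks before the last position \<open>m\<close> produce
      \<open>take m r\<close> letter by letter, the last one produces
      \<open>drop m r\<close>.\<close>
    obtain m where m: "length l = Suc m" using lrP by (cases l) auto
    have init: "map ?g [0..<m] = map (\<lambda>i. [Symbol (r ! i)]) [0..<m]" using m by (intro map_cong) auto
    have "concat (map ?g [0..<length l]) = concat (map ?g [0..<m]) @ map Symbol (drop m r)"
      using m by simp
    then have "concat (map ?g [0..<length l]) = concat (map (\<lambda>i. [Symbol (r ! i)]) [0..<m]) @ map Symbol (drop m r)"
      unfolding init .
    also have "concat (map (\<lambda>i. [Symbol (r ! i)]) [0..<m]) = map Symbol (take m r)"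
      using m lrP by (intro nth_equalityI) (auto simp: sing)
    finally show ?thesis by (simp flip: map_append)
  qed
  ultimately have 2: "par_step core control (enc True True ?bs) (enc True True (map Symbol v))"
    using enc_par_step[of ?bs "map (\<lambda>c. [Symbol c]) x @ map ?g [0..<length l] @ map (\<lambda>c. [Symbol c]) y"] lr(3)
    by (simp add: sing)
  show ?thesis using 1 2 by (meson r_into_rtranclp rtranclp.rtrancl_into_rtrancl)
qed

text \<open>All letters become terminals in the same step: a level containing a terminal is outside
  \<open>control\<close>, so no further step could follow.\<close>

lemma complete:
  assumes "(rewrite P)\<^sup>*\<^sup>* [Nt S] (map Tm z)"
  shows "z \<in> tc_lang core start control"
proof -
  have "(par_step core control)\<^sup>*\<^sup>* (enc True True (map Symbol [Nt S])) (enc True True (map Symbol w))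
    \<and> set w \<subseteq> syms N T" if "(rewrite P)\<^sup>*\<^sup>* [Nt S] w" for w
    using that
  proof (induction rule: rtranclp_induct)
    case base
    then show ?case using S by (auto simp: syms_def)
  next
    case (step w w')
    moreover have "set w' \<subseteq> syms N T" using step rules by (fastforce simp: rewrite_def)
    ultimately show ?case using simulate_rule[OF step.hyps(2)] by (meson rtranclp_trans)
  qed
  from this[OF assms] have chain: "(par_step core control)\<^sup>*\<^sup>* (enc True True [Symbol (Nt S)])
      (enc True True (map Symbol (map Tm z)))" and z: "set (map Tm z) \<subseteq> syms N T"
    by simp_all
  have "letter_step core (Nt start, True) (enc True True [Symbol (Nt S)])"
    using letter_step.expand[of start "[cell (Symbol (Nt S), True, True)]" core]
    by (simp add: core_def enc_def)
  then have first: "par_step core control [(Nt start, True)] (enc True True [Symbol (Nt S)])"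
    by (simp add: par_step_def control_def pair_lang_def)
  have "rewrite_all core (enc f l (map Symbol (map Tm z))) (map (\<lambda>a. (Tm a, True)) z)" for f l
    using z
  proof (induction z arbitrary: f)
    case (Cons a z)
    then have "a \<in> T" by (auto simp: syms_def)
    then have "(e (Some (Symbol (Tm a), f, l \<and> z = [])), [Tm a]) \<in> core"
      unfolding core_def by blast
    from letter_step.expand[OF this]
    have "letter_step core (cell (Symbol (Tm a), f, l \<and> z = []), True) [(Tm a, True)]"
      by (simp add: cell_def)
    then show ?case
      using rewrite_all_append[of core "[(cell (Symbol (Tm a), f, l \<and> z = []), True)]" "[(Tm a, True)]"] Cons
      by (auto simp: enc_def)
  qed (simp add: enc_def)
  moreover have "active (enc True True (map Symbol (map Tm z))) \<in> control"
    using z by (intro enc_control) (auto simp: bases_def successively_Symbol hd_map last_map simp del: map_map)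
  ultimately have "par_step core control (enc True True (map Symbol (map Tm z))) (map (\<lambda>a. (Tm a, True)) z)"
    by (simp add: par_step_def)
  with first chain have "(par_step core control)\<^sup>*\<^sup>* [(Nt start, True)] (map (\<lambda>a. (Tm a, True)) z)"
    by (meson converse_rtranclp_into_rtranclp rtranclp.rtrancl_into_rtrancl)
  then show ?thesis by (auto simp: tc_lang_par_step intro!: exI[of _ "map (\<lambda>a. (Tm a, True)) z"])
qed

section \<open>Soundness by decoding levels into sentential forms\<close>

definition decodes :: "'t sym \<Rightarrow> 't sym \<Rightarrow> bool" where
  "decodes y c \<longleftrightarrow> (\<exists>x\<in>cells. y = cell x \<and> c = base_sym (fst x)) \<or> (\<exists>a. y = Tm a \<and> c = Tm a)"

text \<open>Stated so that it holds vacuously for terminals, which carry no flags.\<close>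

definition "first_ok y \<longleftrightarrow> (\<forall>x\<in>cells. y = cell x \<longrightarrow> fst (snd x))"
definition "last_ok y \<longleftrightarrow> (\<forall>x\<in>cells. y = cell x \<longrightarrow> snd (snd x))"

lemma cell_step:
  assumes "x \<in> cells" and "letter_step core (cell x, True) d"
  shows "\<exists>ys g. d = map (\<lambda>y. (y, True)) ys \<and> list_all2 decodes ys g \<and> emits P (fst x) g \<and> ys \<noteq> []
    \<and> (fst (snd x) \<longrightarrow> first_ok (hd ys)) \<and> (snd (snd x) \<longrightarrow> last_ok (last ys))"
proof -
  obtain w where w: "(e (Some x), w) \<in> core" "d = map (\<lambda>y. (y, True)) w"
    using assms(2) by cases (auto simp: cell_def)
  from w(1) show ?thesis
  proof (cases rule: core_cases)
    case initial
    then show ?thesis using cell_start[OF assms(1)] by (simp add: cell_def)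
  next
    case (base b f l g)
    have x: "x = (b, f, l)" using base(1,3) assms(1) cell_inj[of x "(b, f, l)"] by (auto simp: cell_def cells_def)
    have g: "set g \<subseteq> bases (syms N T) P" "g \<noteq> []" using base_rule_bases[OF base(4,3)] by auto
    have fl: "set (flag f l g) \<subseteq> cells" by (rule flag_cells[OF g(1)])
    have "list_all2 decodes (map cell ys) (map (\<lambda>y. base_sym (fst y)) ys)" if "set ys \<subseteq> cells" for ys
      using that by (induction ys) (auto simp: decodes_def)
    from this[OF fl] have "list_all2 decodes w (map base_sym (map fst (flag f l g)))"
      unfolding base(2) by (simp add: o_def del: map_fst_flag)
    then have "list_all2 decodes w (map base_sym g)" by simp
    moreover have "hd (flag f l g) \<in> cells" "last (flag f l g) \<in> cells"
      using fl g(2) by (meson flag_eq_Nil hd_in_set last_in_set subsetD)+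
    then have "f \<longrightarrow> first_ok (hd w)" "l \<longrightarrow> last_ok (last w)"
      unfolding base(2) using g(2) hd_flag[OF g(2), of f l] last_flag[OF g(2), of f l] cell_inj
      by (auto simp: first_ok_def last_ok_def hd_map last_map)
    ultimately show ?thesis using w(2) base_rule_emits[OF base(4)] x g(2) base(2)
      by (intro exI[of _ w] exI[of _ "map base_sym g"]) auto
  next
    case (final a f l)
    then have "Symbol (Tm a) \<in> bases (syms N T) P" by (auto simp: bases_def syms_def)
    then have x: "x = (Symbol (Tm a), f, l)"
      using final(1) assms(1) cell_inj[of x "(Symbol (Tm a), f, l)"] by (auto simp: cell_def cells_def)
    have "first_ok (Tm a)" "last_ok (Tm a)" by (auto simp: first_ok_def last_ok_def cell_def)
    then show ?thesis using x w(2) final(2) emits.intros(1)[of P "Tm a"]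
      by (intro exI[of _ "[Tm a]"]) (auto simp: decodes_def)
  qed
qed

lemma cells_step:
  assumes "set zs \<subseteq> cells" and "rewrite_all core (map (\<lambda>x. (cell x, True)) zs) d"
  shows "\<exists>ys gs. d = map (\<lambda>y. (y, True)) ys \<and> list_all2 decodes ys (concat gs)
    \<and> list_all2 (emits P) (map fst zs) gs
    \<and> (zs \<noteq> [] \<longrightarrow> ys \<noteq> [] \<and> (fst (snd (hd zs)) \<longrightarrow> first_ok (hd ys)) \<and> (snd (snd (last zs)) \<longrightarrow> last_ok (last ys)))"
  using assms
proof (induction zs arbitrary: d)
  case Nil
  then show ?case by auto
next
  case (Cons x zs)
  then obtain d1 d2 where d: "d = d1 @ d2" "letter_step core (cell x, True) d1"
    "rewrite_all core (map (\<lambda>x. (cell x, True)) zs) d2" by (auto simp: rewrite_all_Cons)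
  obtain ys1 g where 1: "d1 = map (\<lambda>y. (y, True)) ys1" "list_all2 decodes ys1 g" "emits P (fst x) g" "ys1 \<noteq> []"
    "fst (snd x) \<longrightarrow> first_ok (hd ys1)" "snd (snd x) \<longrightarrow> last_ok (last ys1)"
    using cell_step[OF _ d(2)] Cons.prems(1) by auto
  obtain ys2 gs where 2: "d2 = map (\<lambda>y. (y, True)) ys2" "list_all2 decodes ys2 (concat gs)"
    "list_all2 (emits P) (map fst zs) gs"
    "zs \<noteq> [] \<longrightarrow> ys2 \<noteq> [] \<and> (fst (snd (hd zs)) \<longrightarrow> first_ok (hd ys2)) \<and> (snd (snd (last zs)) \<longrightarrow> last_ok (last ys2))"
    using Cons.IH[OF _ d(3)] Cons.prems(1) by auto
  have "zs = [] \<longleftrightarrow> ys2 = []"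
    using 2 by auto
  then show ?case using d(1) 1 2
    by (intro exI[of _ "ys1 @ ys2"] exI[of _ "g # gs"]) (auto simp: list_all2_appendI)
qed

text \<open>A level with a successor lies in \<open>control\<close>, hence consists of cells. The
  flags at its ends make them block boundaries and adjacent cells satisfy \<open>follows\<close>, so
  \<open>emits_sound\<close> turns the parallel step into rewriting steps.\<close>

lemma sound_step:
  assumes "ys \<in> control" and "ys \<noteq> []" and "list_all2 decodes ys w" and "first_ok (hd ys)" and "last_ok (last ys)"
    and "rewrite_all core (map (\<lambda>y. (y, True)) ys) d"
  shows "\<exists>ys' w'. d = map (\<lambda>y. (y, True)) ys' \<and> ys' \<noteq> [] \<and> list_all2 decodes ys' w'
    \<and> first_ok (hd ys') \<and> last_ok (last ys') \<and> (rewrite P)\<^sup>*\<^sup>* w w'"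
proof -
  let ?V = "{(b, f, l) \<in> cells. (f \<longrightarrow> block_start b) \<and> (l \<longrightarrow> block_end b)}"
  \<comment> \<open>The alphabet of \<open>control\<close> also contains the start symbol, which
    decodes to nothing.\<close>
  have nostart: "y \<noteq> Nt start" if "decodes y c" for y c
    using that cell_start unfolding decodes_def by (metis sym.distinct(1))
  have "\<exists>zs. ys = map cell zs \<and> set zs \<subseteq> ?V \<and> w = map base_sym (map fst zs)"
  proof -
    have "set ys \<subseteq> insert (Nt start) (cell ` ?V)" using assms(1) by (auto simp: control_def pair_lang_def)
    with assms(3) show ?thesis
    proof (induction ys w rule: list_all2_induct)
      case (Cons y ys c w)
      then obtain zs where zs: "ys = map cell zs" "set zs \<subseteq> ?V" "w = map base_sym (map fst zs)" by auto
      have "y \<in> insert (Nt start) (cell ` ?V)" using Cons.prems by simp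
      then have "y \<in> cell ` ?V" using nostart[OF Cons.hyps(1)] by blast
      then obtain z where z: "z \<in> ?V" "y = cell z" by blast
      then have zc: "z \<in> cells" by blast
      have "y \<noteq> Tm a" for a using z(2) by (simp add: cell_def)
      then obtain x where "x \<in> cells" "y = cell x" "c = base_sym (fst x)"
        using Cons.hyps(1) unfolding decodes_def by blast
      then have "c = base_sym (fst z)" using cell_inj[OF zc] z(2) by metis
      then have "y # ys = map cell (z # zs) \<and> set (z # zs) \<subseteq> ?V \<and> c # w = map base_sym (map fst (z # zs))"
        using z zs by simp
      then show ?case by (intro exI[where x = "z # zs"])
    qed simp
  qed
  then obtain zs where zs: "ys = map cell zs" "set zs \<subseteq> ?V" "w = map base_sym (map fst zs)" by blast
  have zc: "set zs \<subseteq> cells" using zs(2) by auto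
  have ne: "zs \<noteq> []" using assms(2) zs(1) by auto
  note hdl = subsetD[OF zs(2) hd_in_set[OF ne]] subsetD[OF zs(2) last_in_set[OF ne]]
  have fl: "fst (snd (hd zs))" "snd (snd (last zs))"
  proof -
    note subsetD[OF zc hd_in_set[OF ne]] subsetD[OF zc last_in_set[OF ne]]
    then show "fst (snd (hd zs))" "snd (snd (last zs))"
      using assms(4,5) ne by (simp_all add: zs(1) first_ok_def last_ok_def hd_map last_map)
  qed
  have "successively follows (map fst zs)"
  proof -
    have "successively (\<lambda>x y. \<exists>u\<in>cells. \<exists>v\<in>cells. cell x = cell u \<and> cell y = cell v \<and> follows (fst u) (fst v)) zs"
      using assms(1) by (simp add: control_def pair_lang_def zs(1) successively_map)
    then have "successively (\<lambda>x y. follows (fst x) (fst y)) zs"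
    proof (rule successively_mono)
      fix x y assume "x \<in> set zs" "y \<in> set zs"
        "\<exists>u\<in>cells. \<exists>v\<in>cells. cell x = cell u \<and> cell y = cell v \<and> follows (fst u) (fst v)"
      moreover from this have "x \<in> cells" "y \<in> cells" using zc by blast+
      ultimately show "follows (fst x) (fst y)" using cell_inj by metis
    qed
    then show ?thesis by (simp add: successively_map)
  qed
  moreover obtain ys' gs where ys': "d = map (\<lambda>y. (y, True)) ys'" "list_all2 decodes ys' (concat gs)"
    "list_all2 (emits P) (map fst zs) gs" "ys' \<noteq> []" "first_ok (hd ys')" "last_ok (last ys')"
  proof -
    have "rewrite_all core (map (\<lambda>x. (cell x, True)) zs) d" using assms(6) zs(1) by (simp add: o_def)
    from cells_step[OF zc this] fl ne that show ?thesis by metis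
  qed
  moreover have "block_start (hd (map fst zs)) \<and> block_end (last (map fst zs))"
  proof -
    have V: "block_start (fst x)" if "x \<in> ?V" "fst (snd x)" for x using that by auto
    have V': "block_end (fst x)" if "x \<in> ?V" "snd (snd x)" for x using that by auto
    show ?thesis using V[OF hdl(1) fl(1)] V'[OF hdl(2) fl(2)] ne by (simp add: hd_map last_map)
  qed
  ultimately have "(rewrite P)\<^sup>*\<^sup>* w (concat gs)"
    using emits_sound[of P "map fst zs" gs] rules unfolding zs(3) by blast
  then show ?thesis using ys' by blast
qed

lemma sound:
  assumes "z \<in> tc_lang core start control"
  shows "(rewrite P)\<^sup>*\<^sup>* [Nt S] (map Tm z)"
proof -
  obtain c where c: "(par_step core control)\<^sup>*\<^sup>* [(Nt start, True)] c" "map fst c = map Tm z"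
    using assms by (auto simp: tc_lang_par_step)
  from c(1) have "c = [(Nt start, True)] \<or> (\<exists>ys w. c = map (\<lambda>y. (y, True)) ys \<and> ys \<noteq> [] \<and> list_all2 decodes ys w
    \<and> first_ok (hd ys) \<and> last_ok (last ys) \<and> (rewrite P)\<^sup>*\<^sup>* [Nt S] w)"
  proof (induction rule: rtranclp_induct)
    case (step c d)
    have st: "active c \<in> control" "rewrite_all core c d" using step.hyps(2) by (auto simp: par_step_def)
    from step.IH show ?case
    proof (elim disjE exE conjE)
      assume "c = [(Nt start, True)]"
      then obtain w where w: "(start, w) \<in> core" "d = map (\<lambda>y. (y, True)) w"
        using st(2) by (auto simp: letter_step.simps)
      let ?x = "(Symbol (Nt S), True, True)"
      have nostart: "e (Some (b, f, l)) \<noteq> start" if "b \<in> bases (syms N T) P" for b f l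
        using cell_start[of "(b, f, l)"] that by (simp add: cell_def cells_def)
      from w(1) have wx: "w = [cell ?x]"
      proof (cases rule: core_cases)
        case (base b f l g)
        then show ?thesis using nostart[of b f l] by simp
      next
        case (final a f l)
        then show ?thesis using nostart[of "Symbol (Tm a)" f l] by (simp add: bases_def syms_def)
      qed simp
      have x: "?x \<in> cells" using SymbolS by (simp add: cells_def)
      have "first_ok (cell ?x)" "last_ok (cell ?x)"
        unfolding first_ok_def last_ok_def using cell_inj[OF x] by auto
      moreover have "decodes (cell ?x) (Nt S)"
        unfolding decodes_def by (intro disjI1 bexI[OF _ x]) simp
      ultimately have "d = map (\<lambda>y. (y, True)) w \<and> w \<noteq> [] \<and> list_all2 decodes w [Nt S] \<and> first_ok (hd w)
          \<and> last_ok (last w) \<and> (rewrite P)\<^sup>*\<^sup>* [Nt S] [Nt S]"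
        using w(2) wx by simp
      then show ?thesis by blast
    next
      fix ys w assume ys: "c = map (\<lambda>y. (y, True)) ys" "ys \<noteq> []" "list_all2 decodes ys w"
        "first_ok (hd ys)" "last_ok (last ys)" "(rewrite P)\<^sup>*\<^sup>* [Nt S] w"
      have "ys \<in> control" using st(1) ys(1) by simp
      from sound_step[OF this ys(2-5)] st(2) ys(1)
      obtain ys' w' where "d = map (\<lambda>y. (y, True)) ys'" "ys' \<noteq> []" "list_all2 decodes ys' w'"
        "first_ok (hd ys')" "last_ok (last ys')" "(rewrite P)\<^sup>*\<^sup>* w w'" by blast
      then show ?thesis using rtranclp_trans[OF ys(6)] by blast
    qed
  qed simp
  moreover have "c \<noteq> [(Nt start, True)]" using c(2) by auto
  ultimately obtain ys w where ys: "c = map (\<lambda>y. (y, True)) ys" "list_all2 decodes ys w" "(rewrite P)\<^sup>*\<^sup>* [Nt S] w"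
    by blast
  have "decodes (Tm a) x \<longleftrightarrow> x = Tm a" for a x by (auto simp: decodes_def cell_def)
  then have "list_all2 decodes (map Tm z) w \<Longrightarrow> w = map Tm z" for z w
    by (induction z arbitrary: w) (auto simp: list_all2_Cons1)
  moreover have "ys = map Tm z" using c(2) ys(1) by (simp add: o_def)
  ultimately have "w = map Tm z" using ys(2) by blast
  then show ?thesis using ys(3) by simp
qed

end

lemma (in marking) tc_lang_productions:
  "tc_lang productions start control
   = {z. (rewrite P)\<^sup>*\<^sup>* [Nt S] (map Tm z)} \<union> {z. z = [] \<and> erase}"
proof -
  have cf: "cf_grammar (e ` insert None (Some ` cells)) T productions start"
    using productions_grammar by (simp add: tc_grammar_def)
  have "(start, []) \<in> productions \<longleftrightarrow> erase"
    using core_nonempty[of start "[]"] by (auto simp: productions_def)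
  moreover have "[Nt start] \<in> control" by (simp add: control_def pair_lang_def)
  moreover have "tc_lang core start control = {z. (rewrite P)\<^sup>*\<^sup>* [Nt S] (map Tm z)}"
    using sound complete by blast
  ultimately show ?thesis using tc_lang_erasing[OF cf, of control] by (simp add: nonerasing_productions)
qed

section \<open>Context-sensitive languages are tree-controlled\<close>

lemma cs_rule_cases:
  assumes "cs_grammar N T P S" and "(l, r) \<in> P"
  shows "l \<noteq> [] \<and> (r \<noteq> [] \<and> length l \<le> length r \<or> l = [Nt S] \<and> r = [])
    \<and> (([Nt S], []) \<in> P \<longrightarrow> Nt S \<notin> set r)"
proof -
  have form: "(\<exists>u1 A u2 x. l = u1 @ [Nt A] @ u2 \<and> r = u1 @ x @ u2 \<and> x \<noteq> [])
        \<or> (l = [Nt S] \<and> r = [] \<and> (\<forall>(l', r') \<in> P. Nt S \<notin> set r'))" if "(l, r) \<in> P" for l r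
    using assms(1) that unfolding cs_grammar_def by fast
  have "l \<noteq> [] \<and> (r \<noteq> [] \<and> length l \<le> length r \<or> l = [Nt S] \<and> r = [])"
    using form[OF assms(2)]
  proof (elim disjE exE conjE)
    fix u1 A u2 x assume "l = u1 @ [Nt A] @ u2" "r = u1 @ x @ u2" "x \<noteq> []"
    then show ?thesis by (cases x) auto
  qed simp
  moreover have "Nt S \<notin> set r" if "([Nt S], []) \<in> P"
    using form[OF that] assms(2) by (auto simp: append_eq_Cons_conv)
  ultimately show ?thesis by blast
qed

text \<open>If the axiom is erasable, the only reachable word containing it is
  \<open>[Nt S]\<close>, so erasure can only lead to the empty word.\<close>

lemma cs_chain_nonerasing:
  assumes cs: "cs_grammar N T P S" and "(rewrite P)\<^sup>*\<^sup>* [Nt S] w"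
  shows "(w = [] \<and> ([Nt S], []) \<in> P) \<or> ((rewrite (nonerasing P))\<^sup>*\<^sup>* [Nt S] w
    \<and> (([Nt S], []) \<in> P \<longrightarrow> w = [Nt S] \<or> Nt S \<notin> set w))"
  using assms(2)
proof (induction rule: rtranclp_induct)
  case base
  then show ?case by auto
next
  case (step w w')
  obtain x y l r where lr: "(l, r) \<in> P" "w = x @ l @ y" "w' = x @ r @ y"
    using step.hyps(2) by (auto simp: rewrite_def)
  note rule = cs_rule_cases[OF cs lr(1)]
  have IH: "(rewrite (nonerasing P))\<^sup>*\<^sup>* [Nt S] w" "([Nt S], []) \<in> P \<longrightarrow> w = [Nt S] \<or> Nt S \<notin> set w"
    using step.IH lr(2) rule by auto
  show ?case
  proof (cases "r = []")
    case True
    then have l: "l = [Nt S]" using rule by simp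
    then have "w = [Nt S]" using IH(2) lr True by auto
    then have "w' = []" using lr l True by (auto simp: append_eq_Cons_conv)
    then show ?thesis using lr(1) l True by simp
  next
    case False
    then have "(l, r) \<in> nonerasing P" using lr(1) by (simp add: nonerasing_def)
    then have "rewrite (nonerasing P) w w'" unfolding lr(2,3) by (rule rewriteI)
    with IH(1) have "(rewrite (nonerasing P))\<^sup>*\<^sup>* [Nt S] w'" by (rule rtranclp.rtrancl_into_rtrancl)
    moreover have "Nt S \<notin> set w'" if "([Nt S], []) \<in> P"
    proof -
      have "Nt S \<notin> set x \<union> set y"
      proof (cases "w = [Nt S]")
        case True
        then have "x = [] \<and> y = []" using lr(2) rule by (cases x; cases l) auto
        then show ?thesis by simp
      next
        case False
        then show ?thesis using IH(2) that lr(2) by simp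
      qed
      then show ?thesis using rule that lr(3) by simp
    qed
    ultimately show ?thesis by blast
  qed
qed

lemma cs_lang_erasing:
  assumes "cs_grammar N T P S"
  shows "cs_lang P S = {z. (rewrite (nonerasing P))\<^sup>*\<^sup>* [Nt S] (map Tm z)}
    \<union> {z. z = [] \<and> ([Nt S], []) \<in> P}"
proof (intro set_eqI iffI)
  fix z assume "z \<in> cs_lang P S"
  then have "(rewrite P)\<^sup>*\<^sup>* [Nt S] (map Tm z)" by (simp add: cs_lang_def step_eq_rewrite)
  from cs_chain_nonerasing[OF assms this]
  show "z \<in> {z. (rewrite (nonerasing P))\<^sup>*\<^sup>* [Nt S] (map Tm z)} \<union> {z. z = [] \<and> ([Nt S], []) \<in> P}"
    by blast
next
  fix z assume z: "z \<in> {z. (rewrite (nonerasing P))\<^sup>*\<^sup>* [Nt S] (map Tm z)} \<union> {z. z = [] \<and> ([Nt S], []) \<in> P}"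
  have "rewrite (nonerasing P) \<le> rewrite P"
    by (intro predicate2I) (auto simp: rewrite_def nonerasing_def)
  then have mono: "(rewrite (nonerasing P))\<^sup>*\<^sup>* \<le> (rewrite P)\<^sup>*\<^sup>*" by (rule rtranclp_mono)
  have "(rewrite P)\<^sup>*\<^sup>* [Nt S] (map Tm z)"
  proof (cases "(rewrite (nonerasing P))\<^sup>*\<^sup>* [Nt S] (map Tm z)")
    case True
    then show ?thesis by (rule predicate2D[OF mono])
  next
    case False
    then have "z = []" "([Nt S], []) \<in> P" using z by simp_all
    then show ?thesis using rewriteI[of "[Nt S]" "[]" P "[]" "[]"] by (intro r_into_rtranclp) simp
  qed
  then show "z \<in> cs_lang P S" by (simp add: cs_lang_def step_eq_rewrite)
qed

lemma TC_I: "tc_grammar N T P S R \<Longrightarrow> R \<in> \<F> \<Longrightarrow> tc_lang P S R \<in> TC \<F>"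
  unfolding TC_def mem_Collect_eq by (intro exI conjI) (assumption | rule refl)+

lemma CS_subset_TC_SLT_k:
  assumes "k \<ge> 2"
  shows "(CS :: 't list set set) \<subseteq> TC (SLT_k k)"
proof
  fix L :: "'t list set" assume "L \<in> CS"
  then obtain N T P S where cs: "cs_grammar N T P S" and L: "L = cs_lang P S"
    by (auto simp: CS_def)
  have fin: "finite (syms N T)" "finite T" "finite (nonerasing P)" "S \<in> N"
    using cs by (auto simp: cs_grammar_def syms_def nonerasing_def)
  have finQ: "finite (insert None (Some ` (bases (syms N T) (nonerasing P) \<times> (UNIV :: (bool \<times> bool) set))))"
    using finite_bases[OF fin(1,3)] by simp
  then obtain e :: "('t base \<times> bool \<times> bool) option \<Rightarrow> nat"
    where inj: "inj_on e (insert None (Some ` (bases (syms N T) (nonerasing P) \<times> UNIV)))"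
    using finite_imp_inj_to_nat_seg[OF finQ] by blast
  have rules: "l \<noteq> [] \<and> length l \<le> length r \<and> set l \<subseteq> syms N T \<and> set r \<subseteq> syms N T"
    if lr: "(l, r) \<in> nonerasing P" for l r
  proof -
    have "(l, r) \<in> P" "r \<noteq> []" using lr by (auto simp: nonerasing_def)
    moreover from this(1) have "set l \<subseteq> syms N T \<and> set r \<subseteq> syms N T"
      using cs by (auto simp: cs_grammar_def)
    ultimately show ?thesis using cs_rule_cases[OF cs] by blast
  qed
  \<comment> \<open>The erasing rule is removed from the rules and survives as the Boolean argument
    \<open>erase\<close>.\<close>
  interpret marking N T "nonerasing P" S e "([Nt S], []) \<in> P"
    by unfold_locales (fact fin rules inj)+
  have "finite {(b, f, l) \<in> cells. (f \<longrightarrow> block_start b) \<and> (l \<longrightarrow> block_end b)}"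
    by (rule finite_subset[OF _ finite_cells]) auto
  then have "control \<in> SLT_k k"
    unfolding control_def using assms by (intro pair_lang_SLT_k) simp_all
  then have "tc_lang productions start control \<in> TC (SLT_k k)"
    by (rule TC_I[OF productions_grammar])
  then show "L \<in> TC (SLT_k k)"
    unfolding L cs_lang_erasing[OF cs] tc_lang_productions .
qed

lemma TC_UN: "TC (\<Union>k\<in>K. \<F> k) = (\<Union>k\<in>K. TC (\<F> k))"
  unfolding TC_def by blast

section \<open>From tree-controlled to context-sensitive grammars\<close>

datatype 'q head = Idle | Read 'q | Done 'q | Back

text \<open>The head is a component of a letter and not a letter of its own: rewriting under it is a
  unary rule and moving it a binary rule.\<close>

type_synonym ('t, 'q) letter = "(('t sym \<times> bool) \<times> bool \<times> bool) \<times> 'q head"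

definition idle :: "bool \<Rightarrow> bool \<Rightarrow> ('t sym \<times> bool) list \<Rightarrow> ('t, 'q) letter list" where
  "idle f l c = map (\<lambda>x. (x, Idle)) (flag f l c)"

lemma idle_append: "idle f l (c @ d) = idle f (l \<and> d = []) c @ idle (f \<and> c = []) l d"
  by (simp add: idle_def flag_append)

lemma idle_simps [simp]:
  "idle f l [] = []" "idle f l (p # c) = ((p, f, l \<and> c = []), Idle) # idle False l c"
  by (simp_all add: idle_def)

lemma length_idle [simp]: "length (idle f l c) = length c"
  by (induction c arbitrary: f) auto

lemma snd_idle: "x \<in> set (idle f l c) \<Longrightarrow> snd x = Idle"
  by (auto simp: idle_def)

definition form :: "('t sym \<times> bool) list \<Rightarrow> 't sym \<times> bool \<Rightarrow> 'q head \<Rightarrow> ('t sym \<times> bool) list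
    \<Rightarrow> ('t, 'q) letter list" where
  "form u p h v = idle True False u @ [((p, u = [], v = []), h)] @ idle False True v"

lemma form_append:
  "form (u @ d) y h v = idle True False u @ (idle (u = []) False d @ [((y, u = [] \<and> d = [], v = []), h)])
     @ idle False True v"
  by (simp add: form_def idle_append)

lemma form_before:
  "form u p h (p' # v) = idle True False u @ [((p, u = [], False), h), ((p', False, v = []), Idle)]
     @ idle False True v"
  by (simp add: form_def)

lemma form_after:
  "form (u @ [p]) p' h v = idle True False u @ [((p, u = [], False), Idle), ((p', False, v = []), h)]
     @ idle False True v"
  by (simp add: form_def idle_append)

text \<open>Every sweep rule involves the letter with the head; as there is only one, the place
  where a rule applies is determined.\<close>

lemma split_unique:
  assumes "xs @ a # ys = xs' @ b # ys'" and "K a" and "K b"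
    and "\<forall>x\<in>set xs' \<union> set ys'. \<not> K x"
  shows "xs = xs' \<and> a = b \<and> ys = ys'"
  using assms
proof (induction xs arbitrary: xs')
  case Nil
  then show ?case by (cases xs') auto
next
  case (Cons x xs)
  show ?case
  proof (cases xs')
    case Nil
    then have "a \<in> set ys'" using Cons.prems(1) by auto
    then show ?thesis using Cons.prems by auto
  next
    case (Cons x' xs'')
    then show ?thesis using Cons.IH[of xs''] Cons.prems by auto
  qed
qed

lemma form_split:
  assumes "form u p h v = x @ a # y" and "snd a \<noteq> Idle" and "h \<noteq> Idle"
  shows "x = idle True False u \<and> a = ((p, u = [], v = []), h) \<and> y = idle False True v"
proof -
  have "x @ a # y = idle True False u @ ((p, u = [], v = []), h) # idle False True v"
    using assms(1) by (simp add: form_def)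
  then show ?thesis
    by (rule split_unique[where K = "\<lambda>x. snd x \<noteq> Idle"]) (use assms snd_idle in auto)
qed

section \<open>The sweeping head and its invariant\<close>

locale sweep =
  fixes N :: "nat set" and T :: "'t set" and P :: "(nat \<times> 't sym list) set" and S :: nat
    and Q :: "'q set" and \<delta> :: "'q \<Rightarrow> 't sym \<Rightarrow> 'q" and q0 :: 'q and acc :: "'q \<Rightarrow> bool"
    and R :: "'t sym list set"
  assumes finite_syms: "finite (syms N T)" and finite_P: "finite P" and S: "S \<in> N"
    and rules: "\<And>A w. (A, w) \<in> P \<Longrightarrow> set w \<subseteq> syms N T \<and> w \<noteq> []"
    and recog: "recognises Q \<delta> q0 acc (syms N T) R"
begin

text \<open>Frozen terminals are not part of the level word, so the automaton passes over
  them.\<close>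

definition advance :: "'q \<Rightarrow> 't sym \<times> bool \<Rightarrow> 'q" where
  "advance q p = (if snd p then \<delta> q (fst p) else q)"

definition run :: "('t sym \<times> bool) list \<Rightarrow> 'q" where "run c = foldl \<delta> q0 (active c)"

lemma run_simps: "run [] = q0" "run (c @ [p]) = advance (run c) p"
  by (simp_all add: run_def advance_def)

definition letters :: "('t sym \<times> bool) set" where "letters = syms N T \<times> UNIV"

lemma active_letters: "set c \<subseteq> letters \<Longrightarrow> set (active c) \<subseteq> syms N T"
  by (auto simp: active_def letters_def)

lemma run_acc: "set c \<subseteq> letters \<Longrightarrow> acc (run c) \<longleftrightarrow> active c \<in> R"
  using recog active_letters unfolding run_def recognises_def by blast

lemma advance_Q: "q \<in> Q \<Longrightarrow> p \<in> letters \<Longrightarrow> advance q p \<in> Q"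
  using recog by (auto simp: advance_def recognises_def letters_def)

lemma run_Q: "set c \<subseteq> letters \<Longrightarrow> run c \<in> Q"
proof (induction c rule: rev_induct)
  case Nil
  then show ?case using recog by (simp add: run_simps recognises_def)
next
  case (snoc p c)
  then show ?case using advance_Q by (simp add: run_simps)
qed

lemma letter_step_letters: "letter_step P p d \<Longrightarrow> p \<in> letters \<Longrightarrow> set d \<subseteq> letters \<and> d \<noteq> []"
  by (induction rule: letter_step.induct) (use rules in \<open>auto simp: letters_def\<close>)

lemma rewrite_all_letters:
  "rewrite_all P c d \<Longrightarrow> set c \<subseteq> letters \<Longrightarrow> set d \<subseteq> letters \<and> (d = [] \<longrightarrow> c = [])"
proof (induction c arbitrary: d)
  case (Cons p c)
  then obtain d1 d2 where d: "d = d1 @ d2" "letter_step P p d1" "rewrite_all P c d2"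
    by (auto simp: rewrite_all_Cons)
  then show ?case using Cons.IH[OF d(3)] Cons.prems(2) letter_step_letters[OF d(2)] by auto
qed simp

definition "reach c \<longleftrightarrow> (par_step P R)\<^sup>*\<^sup>* [(Nt S, True)] c"

lemma reach_letters: "reach c \<Longrightarrow> set c \<subseteq> letters \<and> c \<noteq> []"
  unfolding reach_def
proof (induction rule: rtranclp_induct)
  case base
  then show ?case using S by (auto simp: letters_def syms_def)
next
  case (step c d)
  then show ?case using rewrite_all_letters[of c d] by (auto simp: par_step_def)
qed

lemma reach_step: "reach c \<Longrightarrow> rewrite_all P c d \<Longrightarrow> acc (run c) \<Longrightarrow> reach d"
proof -
  assume "reach c" "rewrite_all P c d" "acc (run c)"
  moreover from this have "par_step P R c d"
    using run_acc[of c] reach_letters[of c] by (simp add: par_step_def)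
  ultimately show "reach d" unfolding reach_def by (meson rtranclp.rtrancl_into_rtrancl)
qed

text \<open>\<open>Done\<close> differs from \<open>Read\<close> so that a letter just written is
  not rewritten again in the same sweep. The head lands on the last letter of the replacement. At
  the right end the rule is available only if the automaton accepts.\<close>

inductive sweep_rule :: "('t, 'q) letter list \<Rightarrow> ('t, 'q) letter list \<Rightarrow> bool" where
  read: "letter_step P p (d @ [y]) \<Longrightarrow> p \<in> letters \<Longrightarrow> q \<in> Q \<Longrightarrow> l \<longrightarrow> acc (advance q p) \<Longrightarrow>
    sweep_rule [((p, f, l), Read q)]
      (idle f False d @ [((y, f \<and> d = [], l), if l then Back else Done (advance q p))])"
| move: "p \<in> letters \<Longrightarrow> p' \<in> letters \<Longrightarrow> q \<in> Q \<Longrightarrow>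
    sweep_rule [((p, f, False), Done q), ((p', False, l), Idle)]
      [((p, f, False), Idle), ((p', False, l), Read q)]"
| retreat: "p \<in> letters \<Longrightarrow> p' \<in> letters \<Longrightarrow>
    sweep_rule [((p, f, False), Idle), ((p', False, l), Back)]
      [((p, f, False), Back), ((p', False, l), Idle)]"
| turn: "p \<in> letters \<Longrightarrow> sweep_rule [((p, True, l), Back)] [((p, True, l), Read q0)]"

definition "sweep_rules = {(l, r). sweep_rule l r}"

definition "alphabet = (letters \<times> (UNIV :: (bool \<times> bool) set)) \<times> ({Idle, Back} \<union> Read ` Q \<union> Done ` Q)"

lemma idle_alphabet: "set d \<subseteq> letters \<Longrightarrow> set (idle f l d) \<subseteq> alphabet"
  by (induction d arbitrary: f) (auto simp: alphabet_def)

lemma sweep_rule_alphabet: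
  assumes "sweep_rule l r"
  shows "set l \<subseteq> alphabet \<and> set r \<subseteq> alphabet"
  using assms
proof cases
  case (read p d y q l' f)
  have "set (d @ [y]) \<subseteq> letters" using letter_step_letters[OF read(3,4)] by simp
  then show ?thesis using read idle_alphabet[of d f False] advance_Q[OF read(5,4)]
    by (auto simp: alphabet_def)
next
  case (turn p l')
  then show ?thesis using recog by (auto simp: alphabet_def recognises_def)
qed (auto simp: alphabet_def)

lemma sweep_rule_length:
  "\<exists>m. \<forall>l r. sweep_rule l r \<longrightarrow> length l \<le> 2 \<and> length r \<le> m"
proof -
  define m where "m = Max (insert 2 (length ` snd ` P))"
  have fin: "finite (insert 2 (length ` snd ` P))" using finite_P by simp
  have m2: "2 \<le> m" unfolding m_def using fin by (intro Max_ge) auto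
  have mP: "length w \<le> m" if "(A, w) \<in> P" for A w
    unfolding m_def using fin that by (intro Max_ge) force+
  have ml: "length d \<le> m" if "letter_step P p d" for p d
    using that m2 mP by cases auto
  have "length l \<le> 2 \<and> length r \<le> m" if "sweep_rule l r" for l r
    using that
  proof cases
    case (read p d y q l' f)
    then show ?thesis using ml[OF read(3)] by simp
  qed (use m2 in auto)
  then show ?thesis by blast
qed

lemma sweep_unary_or_binary: "unary_or_binary alphabet sweep_rules"
proof -
  have fin: "finite alphabet"
    using finite_syms recog unfolding alphabet_def letters_def recognises_def
    by (intro finite_cartesian_product finite_UnI finite_imageI) simp_all
  obtain m where m: "\<And>l r. sweep_rule l r \<Longrightarrow> length l \<le> 2 \<and> length r \<le> m"
    using sweep_rule_length by blast
  have "sweep_rules \<subseteq> {l. set l \<subseteq> alphabet \<and> length l \<le> 2} \<times> {r. set r \<subseteq> alphabet \<and> length r \<le> m}"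
    using m sweep_rule_alphabet unfolding sweep_rules_def by blast
  then have "finite sweep_rules"
    by (rule finite_subset) (intro finite_cartesian_product finite_lists_length_le fin)
  moreover have "(\<exists>c. l = [c] \<and> r \<noteq> []) \<or> (\<exists>a b c d. l = [a, b] \<and> r = [c, d])" if "sweep_rule l r" for l r
    using that by cases auto
  ultimately show ?thesis using fin sweep_rule_alphabet
    unfolding unary_or_binary_def sweep_rules_def by blast
qed

text \<open>In mid-sweep the word is half new and half old: \<open>u0\<close> is the old prefix,
  already replaced by the new one. Only the old configuration is known to be reachable, because
  membership of its level in \<open>R\<close> is still undecided.\<close>

definition consistent :: "('t, 'q) letter list \<Rightarrow> bool" where
  "consistent w \<longleftrightarrow> (\<exists>u p v.
      (reach (u @ p # v) \<and> w = form u p Back v)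
    \<or> (\<exists>u0. rewrite_all P u0 u \<and> reach (u0 @ p # v) \<and> w = form u p (Read (run u0)) v)
    \<or> (\<exists>u0. rewrite_all P u0 (u @ [p]) \<and> v \<noteq> [] \<and> reach (u0 @ v) \<and> w = form u p (Done (run u0)) v))"

lemma consistent_Back: "reach (u @ p # v) \<Longrightarrow> consistent (form u p Back v)"
  unfolding consistent_def by blast

lemma consistent_Read:
  "rewrite_all P u0 u \<Longrightarrow> reach (u0 @ p # v) \<Longrightarrow> consistent (form u p (Read (run u0)) v)"
  unfolding consistent_def by blast

lemma consistent_Done:
  "rewrite_all P u0 (u @ [p]) \<Longrightarrow> v \<noteq> [] \<Longrightarrow> reach (u0 @ v) \<Longrightarrow> consistent (form u p (Done (run u0)) v)"
  unfolding consistent_def by blast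

lemma consistent_cases:
  assumes "consistent w"
  obtains u p h v where "w = form u p h v" "h \<noteq> Idle"
    "h = Back \<Longrightarrow> reach (u @ p # v)"
    "\<And>q. h = Read q \<Longrightarrow> \<exists>u0. q = run u0 \<and> rewrite_all P u0 u \<and> reach (u0 @ p # v)"
    "\<And>q. h = Done q \<Longrightarrow> \<exists>u0. q = run u0 \<and> rewrite_all P u0 (u @ [p]) \<and> reach (u0 @ v)"
  using assms unfolding consistent_def
proof (elim exE disjE conjE)
  fix u p v assume "reach (u @ p # v)" "w = form u p Back v"
  then show thesis by (intro that[of u p Back v]) simp_all
next
  fix u p v u0 assume "rewrite_all P u0 u" "reach (u0 @ p # v)" "w = form u p (Read (run u0)) v"
  then show thesis by (intro that[of u p "Read (run u0)" v]) auto
next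
  fix u p v u0
  assume "rewrite_all P u0 (u @ [p])" "reach (u0 @ v)" "w = form u p (Done (run u0)) v"
  then show thesis by (intro that[of u p "Done (run u0)" v]) auto
qed

lemma consistent_step:
  assumes "consistent w" and "rewrite sweep_rules w w'"
  shows "consistent w'"
proof -
  obtain u p h v where w: "w = form u p h v" "h \<noteq> Idle"
    and Back: "h = Back \<Longrightarrow> reach (u @ p # v)"
    and Read: "\<And>q. h = Read q \<Longrightarrow> \<exists>u0. q = run u0 \<and> rewrite_all P u0 u \<and> reach (u0 @ p # v)"
    and Done: "\<And>q. h = Done q \<Longrightarrow> \<exists>u0. q = run u0 \<and> rewrite_all P u0 (u @ [p]) \<and> reach (u0 @ v)"
    using consistent_cases[OF assms(1)] by metis
  obtain x y l r where lr: "sweep_rule l r" "w = x @ l @ y" "w' = x @ r @ y"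
    using assms(2) by (auto simp: rewrite_def sweep_rules_def)
  show ?thesis
    using lr(1)
  proof cases
    case (read p1 d y1 q l' f)
    have m: "x = idle True False u" "p1 = p" "f = (u = [])" "l' = (v = [])" "h = Read q" "y = idle False True v"
      using form_split[of u p h v x "((p1, f, l'), Read q)" y] w lr(2) read(1) by auto
    then obtain u0 where u0: "q = run u0" "rewrite_all P u0 u" "reach (u0 @ p # v)" using Read by blast
    have all: "rewrite_all P (u0 @ [p]) ((u @ d) @ [y1])"
      using rewrite_all_append[OF u0(2), of "[p]" "d @ [y1]"] read(3) m by simp
    have w': "w' = form (u @ d) y1 (if v = [] then Back else Done (run (u0 @ [p]))) v"
      unfolding form_append lr(3) read(2) using m u0(1) by (simp add: run_simps)
    show ?thesis
    proof (cases "v = []")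
      \<comment> \<open>At the right end the side condition of \<open>read\<close> gives acceptance
        of the whole old level, so the new configuration is reachable.\<close>
      case True
      then have "reach ((u @ d) @ [y1])"
        using reach_step[OF _ all] u0 read(6) m by (simp add: run_simps)
      then show ?thesis unfolding w' using True consistent_Back[of "u @ d" y1 "[]"] by simp
    next
      case False
      have "reach ((u0 @ [p]) @ v)" using u0(3) by simp
      from consistent_Done[OF all False this] show ?thesis unfolding w' using False by simp
    qed
  next
    case (move p1 p2 q f l')
    have m: "x = idle True False u" "p1 = p" "f = (u = [])" "h = Done q"
      "((p2, False, l'), Idle) # y = idle False True v"
      using form_split[of u p h v x "((p1, f, False), Done q)" "((p2, False, l'), Idle) # y"] w lr(2) move(1)
      by auto
    obtain v' where v: "v = p2 # v'" "l' = (v' = [])" "y = idle False True v'"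
      using m(5) by (cases v) auto
    have "w' = form (u @ [p]) p2 (Read q) v'"
      unfolding form_after lr(3) move(2) using m v by simp
    moreover obtain u0 where "q = run u0" "rewrite_all P u0 (u @ [p])" "reach (u0 @ v)"
      using Done[OF m(4)] by blast
    ultimately show ?thesis using consistent_Read[of u0 "u @ [p]" p2 v'] v(1) by simp
  next
    case (retreat p1 p2 f l')
    have m: "x @ [((p1, f, False), Idle)] = idle True False u" "p2 = p" "l' = (v = [])" "h = Back"
      "y = idle False True v"
      using form_split[of u p h v "x @ [((p1, f, False), Idle)]" "((p2, False, l'), Back)" y] w lr(2) retreat(1)
      by auto
    obtain u' where u: "u = u' @ [p1]" "f = (u' = [])" "x = idle True False u'"
      using m(1) by (cases u rule: rev_cases) (auto simp: idle_append)
    have "w' = form u' p1 Back (p # v)"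
      unfolding form_before lr(3) retreat(2) using m u by simp
    moreover have "reach (u' @ p1 # p # v)" using Back[OF m(4)] u(1) by simp
    ultimately show ?thesis using consistent_Back by simp
  next
    case (turn p1 l')
    have m: "x = idle True False u" "p1 = p" "u = []" "l' = (v = [])" "h = Back" "y = idle False True v"
      using form_split[of u p h v x "((p1, True, l'), Back)" y] w lr(2) turn(1) by auto
    have "w' = form [] p (Read (run [])) v"
      unfolding lr(3) turn(2) using m by (simp add: form_def run_simps)
    moreover have "reach ([] @ p # v)" using Back[OF m(5)] m(3) by simp
    ultimately show ?thesis using consistent_Read[of "[]" "[]" p v] by simp
  qed
qed

section \<open>Every parallel step is carried out by a sweep\<close>

lemma sweep_step: "sweep_rule l r \<Longrightarrow> rewrite sweep_rules (x @ l @ y) (x @ r @ y)"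
  by (rule rewriteI) (simp add: sweep_rules_def)

text \<open>Both the written prefix \<open>u\<close> and its origin \<open>u0\<close> have to vary
  in the induction: flags depend on the former, the state on the latter.\<close>

lemma forward_sweep:
  assumes "rewrite_all P (p # v) d" and "set (u0 @ p # v) \<subseteq> letters" and "acc (run (u0 @ p # v))"
  shows "\<exists>d' y. u @ d = d' @ [y] \<and> (rewrite sweep_rules)\<^sup>*\<^sup>* (form u p (Read (run u0)) v) (form d' y Back [])"
  using assms
proof (induction v arbitrary: p d u u0)
  case Nil
  then have st: "letter_step P p d" by simp
  have pl: "p \<in> letters" using Nil.prems by simp
  obtain d' y where d: "d = d' @ [y]" using letter_step_letters[OF st pl] by (cases d rule: rev_cases) auto
  have "sweep_rule [((p, u = [], True), Read (run u0))]
      (idle (u = []) False d' @ [((y, u = [] \<and> d' = [], True), if True then Back else Done (advance (run u0) p))])"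
    using st d pl run_Q[of u0] Nil.prems by (intro sweep_rule.read) (auto simp: run_simps)
  from sweep_step[OF this, of "idle True False u" "[]"]
  have "rewrite sweep_rules (form u p (Read (run u0)) []) (form (u @ d') y Back [])"
    unfolding form_append by (simp add: form_def)
  then show ?case using d by (intro exI[of _ "u @ d'"] exI[of _ y]) auto
next
  case (Cons p' v)
  obtain d1 d2 where d12: "d = d1 @ d2" and st: "letter_step P p d1" and d2: "rewrite_all P (p' # v) d2"
    using Cons.prems(1) rewrite_all_Cons[of P p "p' # v" d] by auto
  have pl: "p \<in> letters" "p' \<in> letters" using Cons.prems by auto
  obtain d' y where d: "d1 = d' @ [y]" using letter_step_letters[OF st pl(1)] by (cases d1 rule: rev_cases) auto
  have yl: "y \<in> letters" using letter_step_letters[OF st pl(1)] d by simp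
  have q: "run u0 \<in> Q" "run (u0 @ [p]) \<in> Q" using Cons.prems(2) by (auto intro!: run_Q)
  have "sweep_rule [((p, u = [], False), Read (run u0))]
      (idle (u = []) False d' @ [((y, u = [] \<and> d' = [], False), if False then Back else Done (advance (run u0) p))])"
    using st d pl q by (intro sweep_rule.read) auto
  from sweep_step[OF this, of "idle True False u" "idle False True (p' # v)"]
  have 1: "rewrite sweep_rules (form u p (Read (run u0)) (p' # v)) (form (u @ d') y (Done (run (u0 @ [p]))) (p' # v))"
    unfolding form_append by (simp add: form_def run_simps)
  from sweep_step[OF sweep_rule.move[OF yl pl(2) q(2), of "u @ d' = []" "v = []"],
      of "idle True False (u @ d')" "idle False True v"]
  have 2: "rewrite sweep_rules (form (u @ d') y (Done (run (u0 @ [p]))) (p' # v))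
      (form ((u @ d') @ [y]) p' (Read (run (u0 @ [p]))) v)"
    unfolding form_before form_after .
  have "set ((u0 @ [p]) @ p' # v) \<subseteq> letters" "acc (run ((u0 @ [p]) @ p' # v))"
    using Cons.prems(2,3) by auto
  from Cons.IH[OF d2 this, of "(u @ d') @ [y]"]
  obtain e x where e: "((u @ d') @ [y]) @ d2 = e @ [x]"
    and 3: "(rewrite sweep_rules)\<^sup>*\<^sup>* (form ((u @ d') @ [y]) p' (Read (run (u0 @ [p]))) v) (form e x Back [])"
    by blast
  have "(rewrite sweep_rules)\<^sup>*\<^sup>* (form u p (Read (run u0)) (p' # v)) (form e x Back [])"
    using converse_rtranclp_into_rtranclp[OF 1 converse_rtranclp_into_rtranclp[OF 2 3]] .
  moreover have "u @ d = e @ [x]" using e d12 d by simp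
  ultimately show ?case by blast
qed

lemma return_sweep:
  assumes "set (u @ p # v) \<subseteq> letters" and "u @ p # v = p' # v'"
  shows "(rewrite sweep_rules)\<^sup>*\<^sup>* (form u p Back v) (form [] p' (Read q0) v')"
  using assms
proof (induction u arbitrary: p v rule: rev_induct)
  case Nil
  then have "sweep_rule [((p, True, v = []), Back)] [((p, True, v = []), Read q0)]"
    by (intro sweep_rule.turn) auto
  from sweep_step[OF this, of "[]" "idle False True v"] show ?case using Nil by (simp add: form_def)
next
  case (snoc x u)
  have "sweep_rule [((x, u = [], False), Idle), ((p, False, v = []), Back)]
      [((x, u = [], False), Back), ((p, False, v = []), Idle)]"
    using snoc.prems by (intro sweep_rule.retreat) auto
  from sweep_step[OF this, of "idle True False u" "idle False True v"]
  have "rewrite sweep_rules (form (u @ [x]) p Back v) (form u x Back (p # v))"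
    unfolding form_before form_after .
  moreover have "(rewrite sweep_rules)\<^sup>*\<^sup>* (form u x Back (p # v)) (form [] p' (Read q0) v')"
  proof (rule snoc.IH)
    show "set (u @ x # p # v) \<subseteq> letters" using snoc.prems(1) by simp
    show "u @ x # p # v = p' # v'" using snoc.prems(2) by simp
  qed
  ultimately show ?case by (rule converse_rtranclp_into_rtranclp)
qed

definition start_letter :: "('t, 'q) letter" where
  "start_letter = (((Nt S, True), True, True), Read q0)"

lemma sweep_par_step:
  assumes "set (p # v) \<subseteq> letters" and "par_step P R (p # v) c"
  shows "\<exists>d' y. c = d' @ [y] \<and> (rewrite sweep_rules)\<^sup>*\<^sup>* (form [] p (Read q0) v) (form d' y Back [])"
  using forward_sweep[of p v c "[]" "[]"] assms run_acc[of "p # v"] by (auto simp: par_step_def run_simps)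

lemma sweep_complete:
  assumes "(par_step P R)\<^sup>*\<^sup>* [(Nt S, True)] c"
  shows "\<exists>p v. c = p # v \<and> (rewrite sweep_rules)\<^sup>*\<^sup>* [start_letter] (form [] p (Read q0) v)"
  using assms
proof (induction rule: rtranclp_induct)
  case base
  then show ?case by (auto simp: form_def start_letter_def)
next
  case (step c c')
  then obtain p v where pv: "c = p # v" "(rewrite sweep_rules)\<^sup>*\<^sup>* [start_letter] (form [] p (Read q0) v)"
    by blast
  have "set (p # v) \<subseteq> letters" "set c' \<subseteq> letters" "c' \<noteq> []"
    using reach_letters[of c] reach_letters[of c'] step.hyps pv(1) unfolding reach_def
    by (auto intro: rtranclp.rtrancl_into_rtrancl)
  moreover from this obtain d' y where dy: "c' = d' @ [y]"
    "(rewrite sweep_rules)\<^sup>*\<^sup>* (form [] p (Read q0) v) (form d' y Back [])"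
    using sweep_par_step[of p v c'] step.hyps(2) pv(1) by blast
  moreover obtain p' v' where "c' = p' # v'" using \<open>c' \<noteq> []\<close> by (cases c') auto
  moreover from this have "(rewrite sweep_rules)\<^sup>*\<^sup>* (form d' y Back []) (form [] p' (Read q0) v')"
    using return_sweep[of d' y "[]"] dy(1) \<open>set c' \<subseteq> letters\<close> by auto
  ultimately show ?case using pv(2) by (meson rtranclp_trans)
qed

fun terminal :: "'t sym \<Rightarrow> 't option" where
  "terminal (Tm a) = Some a"
| "terminal (Nt A) = None"

lemma map_terminal: "map terminal w = map Some z \<longleftrightarrow> w = map Tm z"
proof (induction w arbitrary: z)
  case (Cons x w)
  then show ?case by (cases z; cases x) auto
qed auto

text \<open>\<open>Read\<close> and \<open>Done\<close> have no image, so a word with a terminal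
  image has its head in \<open>Back\<close> and represents a fully rewritten configuration.\<close>

definition final :: "('t, 'q) letter \<Rightarrow> 't option" where
  "final x = (if snd x \<in> {Idle, Back} then terminal (fst (fst (fst x))) else None)"

lemma final_idle: "map final (idle f l c) = map terminal (map fst c)"
  by (induction c arbitrary: f) (simp_all add: final_def)

lemma final_form: "map final (form u p Back v) = map Some z \<longleftrightarrow> map fst (u @ p # v) = map Tm z"
proof -
  have "map final (form u p Back v) = map terminal (map fst (u @ p # v))"
    by (simp add: form_def final_idle del: map_map) (simp add: final_def)
  then show ?thesis by (simp only: map_terminal)
qed

lemma tc_lang_sweep:
  "tc_lang P S R = {z. \<exists>w. (rewrite sweep_rules)\<^sup>*\<^sup>* [start_letter] w \<and> map final w = map Some z}"
proof (intro set_eqI iffI)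
  fix z assume "z \<in> tc_lang P S R"
  then obtain c where c: "(par_step P R)\<^sup>*\<^sup>* [(Nt S, True)] c" "map fst c = map Tm z"
    by (auto simp: tc_lang_par_step)
  from c(1) show "z \<in> {z. \<exists>w. (rewrite sweep_rules)\<^sup>*\<^sup>* [start_letter] w \<and> map final w = map Some z}"
  proof (cases rule: rtranclp.cases)
    case rtrancl_refl
    then show ?thesis using c(2) by auto
  next
    \<comment> \<open>The last parallel step is simulated without the return, which leaves the head
      in \<open>Back\<close> on the last letter.\<close>
    case (rtrancl_into_rtrancl c0)
    obtain p v where pv: "c0 = p # v" "(rewrite sweep_rules)\<^sup>*\<^sup>* [start_letter] (form [] p (Read q0) v)"
      using sweep_complete[OF rtrancl_into_rtrancl(1)] rtrancl_into_rtrancl(2) by blast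
    have "set (p # v) \<subseteq> letters" using reach_letters[of c0] rtrancl_into_rtrancl pv(1) by (simp add: reach_def)
    then obtain d' y where dy: "c = d' @ [y]"
      "(rewrite sweep_rules)\<^sup>*\<^sup>* (form [] p (Read q0) v) (form d' y Back [])"
      using sweep_par_step[of p v c] rtrancl_into_rtrancl pv(1) by blast
    then have "map final (form d' y Back []) = map Some z" using c(2) final_form[of d' y "[]" z] by simp
    then show ?thesis using rtranclp_trans[OF pv(2) dy(2)] by blast
  qed
next
  fix z assume "z \<in> {z. \<exists>w. (rewrite sweep_rules)\<^sup>*\<^sup>* [start_letter] w \<and> map final w = map Some z}"
  then obtain w where w: "(rewrite sweep_rules)\<^sup>*\<^sup>* [start_letter] w" "map final w = map Some z" by blast
  have "consistent w" using w(1)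
  proof (induction rule: rtranclp_induct)
    case base
    have "reach ([] @ [(Nt S, True)])" by (simp add: reach_def)
    moreover have "[start_letter] = form [] (Nt S, True) (Read (run [])) []"
      by (simp add: form_def start_letter_def run_simps)
    ultimately show ?case using consistent_Read[of "[]" "[]" "(Nt S, True)" "[]"] by simp
  next
    case (step w w')
    then show ?case using consistent_step by blast
  qed
  then obtain u p h v where f: "w = form u p h v" "h \<noteq> Idle" "h = Back \<Longrightarrow> reach (u @ p # v)"
    by (elim consistent_cases) (rule that; blast)
  have "((p, u = [], v = []), h) \<in> set w" using f(1) by (simp add: form_def)
  then have "final ((p, u = [], v = []), h) \<in> set (map final w)" by simp
  then have "final ((p, u = [], v = []), h) \<noteq> None" unfolding w(2) by auto
  then have "h = Back" using f(2) by (auto simp: final_def split: if_splits)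
  then show "z \<in> tc_lang P S R"
    using f w(2) final_form[of u p v z] unfolding tc_lang_par_step reach_def by blast
qed

end

section \<open>Tree-controlled languages are context-sensitive, and the equalities\<close>

lemma TC_SLT_k_subset_CS:
  assumes "k \<ge> 1"
  shows "TC (SLT_k k) \<subseteq> (CS :: 't list set set)"
proof
  fix L :: "'t list set" assume "L \<in> TC (SLT_k k)"
  then obtain N T P S R where G: "tc_grammar N T P S R" "R \<in> SLT_k k" "L = tc_lang P S R"
    by (auto simp: TC_def)
  have cf: "cf_grammar N T P S" using G(1) by (simp add: tc_grammar_def)
  have fin: "finite (syms N T)" using cf by (auto simp: cf_grammar_def syms_def)
  obtain Q :: "('t sym list \<times> bool \<times> bool) set" and \<delta> q0 acc
    where rec: "recognises Q \<delta> q0 acc (syms N T) R"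
    using slt_recognises[OF G(2) assms fin] by blast
  interpret sweep N T "nonerasing P" S Q \<delta> q0 acc R
    by unfold_locales (use cf fin rec in \<open>auto simp: cf_grammar_def nonerasing_def\<close>)
  have "start_letter \<in> alphabet"
    using S rec by (auto simp: start_letter_def alphabet_def letters_def syms_def recognises_def)
  \<comment> \<open>The Boolean argument records whether the control language lets the axiom be
    erased at the root.\<close>
  from rewriting_in_CS[OF sweep_unary_or_binary this, of final "(S, []) \<in> P \<and> [Nt S] \<in> R"]
  show "L \<in> CS" unfolding G(3) tc_lang_erasing[OF cf] tc_lang_sweep by simp
qed

theorem mainTheorem1:
  shows "(\<forall>k::nat. k \<ge> 2 \<longrightarrow> (TC (SLT_k k) :: 't list set set) = CS)
         \<and> (TC SLT :: 't list set set) = CS"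
proof (intro conjI allI impI)
  fix k :: nat assume "k \<ge> 2"
  then show "(TC (SLT_k k) :: 't list set set) = CS"
    using TC_SLT_k_subset_CS[of k] CS_subset_TC_SLT_k[of k] by auto
next
  \<comment> \<open>The lower bound for the union already comes from \<open>k = 2\<close>, the upper
    bound from each \<open>k \<ge> 1\<close> separately.\<close>
  have "(CS :: 't list set set) \<subseteq> TC (SLT_k 2)" by (rule CS_subset_TC_SLT_k) simp
  moreover have "(TC SLT :: 't list set set) = (\<Union>k\<in>{k. k \<ge> 1}. TC (SLT_k k))"
    unfolding SLT_def by (rule TC_UN)
  moreover have "(2::nat) \<in> {k. k \<ge> 1}" by simp
  ultimately show "(TC SLT :: 't list set set) = CS"
    using TC_SLT_k_subset_CS by blast
qed

end
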